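(* Let $n$ be an $\mathbb{N}$-valued random variable with full support on $\mathbb{N}$. Given $n$, let $\mathcal{H}_n=\{H_{j,2l-1}:1\le j\le n+1,\ 1\le l\le 2^{j-1}\}$ be absolutely continuous probability measures on $\Theta$, each with full support on $\Theta$, such that $H_{j,1}$ and $H_{j,2^{j+1}-3}$ (whenever these belong to $\mathcal{H}_n$) have finite first moment. Assume $P_{\boldsymbol\eta}$ has full support on $\mathbb{R}_+$, and that, given $n$, $G\sim\mathrm{DSBASp}(n,\mathcal{H}_n,\boldsymbol\eta)$. Then the support of the law of $G$ in $\mathcal{P}(\Theta\times\mathbb{R}_+)$ with the weak topology is all of $\mathcal{P}(\Theta\times\mathbb{R}_+)$.
   Context: $\Theta\subseteq\mathbb{R}$ is $\mathbb{R}$, a closed half-line, or a compact interval with nonempty interior; $\mathbb{R}_+=[0,\infty)$; $\mathcal{P}(X)$ is the set of Borel probability measures on $X$ with the weak topology. Location nodes: with $\mu_{j,0}=\inf\Theta$, $\mu_{j,2^j}=\sup\Theta$, draw $\mu_{1,1}\sim H_{1,1}$; for $j=2,\ldots,n+1$ set $\mu_{j,2l}=\mu_{j-1,l}$ ($1\le l\le 2^{j-1}-1$) and draw independently $\mu_{j,2l-1}$ from $H_{j,2l-1}$ conditioned to $(\mu_{j-1,l-1},\mu_{j-1,l}]$ ($1\le l\le 2^{j-1}$). Node values: $F(\mu_{j,0})=0$, $F(\mu_{j,2^j})=1$, $F(\mu_{j,2l})=F(\mu_{j-1,l})$, and for $1\le j\le n$, $1\le l\le 2^{j-1}$, $F(\mu_{j,2l-1})=F(\mu_{j-1,l-1})+[F(\mu_{j-1,l})-F(\mu_{j-1,l-1})]\frac{\mu_{j+1,4l-1}-\mu_{j+1,4l-2}}{\mu_{j+1,4l-1}-\mu_{j+1,4l-3}}$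 with $0/0=1$. $\mathrm{DSBASp}(n,\mathcal{H}_n,\boldsymbol\eta)$: with $m=2^n$, $P_{\boldsymbol\eta}$ a probability distribution on $\mathbb{R}_+$, draw $\phi_1,\ldots,\phi_m$ i.i.d. from $P_{\boldsymbol\eta}$ independently of the location nodes, and set $G=\sum_{l=1}^m w_{n,l}\delta_{(\theta_l,\phi_l)}$ with $\theta_l=\mu_{n+1,2l-1}$ and $w_{n,l}=F(\mu_{n,l})-F(\mu_{n,l-1})$. *)

theory Defs
  imports "HOL-Probability.Probability"
begin

text \<open>Parameter space Theta = {x. a <= x <= b} with extended-real endpoints a < b:
  covers R, closed half-lines and compact intervals with nonempty interior.\<close>
definition Theta :: "ereal \<Rightarrow> ereal \<Rightarrow> real set" where
  "Theta a b = {x. a \<le> ereal x \<and> ereal x \<le> b}"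

text \<open>Indices of newly drawn (odd) nodes at level j, and all drawn nodes up to level j.
  The drawn values are stored in x (j,k) for odd k.\<close>
definition odd_idx :: "nat \<Rightarrow> nat set" where
  "odd_idx j = {k. odd k \<and> k < 2 ^ j}"

definition Lev :: "nat \<Rightarrow> (nat \<times> nat) set" where
  "Lev j = {(i, k). 1 \<le> i \<and> i \<le> j \<and> k \<in> odd_idx i}"

fun node :: "ereal \<Rightarrow> ereal \<Rightarrow> (nat \<times> nat \<Rightarrow> real) \<Rightarrow> nat \<Rightarrow> nat \<Rightarrow> ereal" where
  "node a b x 0 k = (if k = 0 then a else b)"
| "node a b x (Suc j) k =
     (if k = 0 then a else if 2 ^ Suc j \<le> k then b
      else if even k then node a b x j (k div 2) else ereal (x (Suc j, k)))"

text \<open>Interval (mu_{j,l-1}, mu_{j,l}] into which mu_{j+1,2l-1} = mu_{j+1,k} is drawn.\<close>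
definition gap :: "ereal \<Rightarrow> ereal \<Rightarrow> (nat \<times> nat \<Rightarrow> real) \<Rightarrow> nat \<Rightarrow> nat \<Rightarrow> real set" where
  "gap a b x j k = {t. node a b x j ((k + 1) div 2 - 1) < ereal t \<and> ereal t \<le> node a b x j ((k + 1) div 2)}"

fun locs :: "ereal \<Rightarrow> ereal \<Rightarrow> (nat \<Rightarrow> nat \<Rightarrow> real measure) \<Rightarrow> nat \<Rightarrow> (nat \<times> nat \<Rightarrow> real) measure" where
  "locs a b H 0 = PiM {} (\<lambda>_. borel)"
| "locs a b H (Suc j) = locs a b H j \<bind> (\<lambda>x.
     distr (PiM (odd_idx (Suc j)) (\<lambda>k. uniform_measure (H (Suc j) k) (gap a b x j k)))
           (PiM (Lev (Suc j)) (\<lambda>_. borel))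
           (\<lambda>y. \<lambda>(i, k). if (i, k) \<in> Lev (Suc j) then (if i = Suc j then y k else x (i, k)) else undefined))"

definition ratio0 :: "real \<Rightarrow> real \<Rightarrow> real" where
  "ratio0 p q = (if p = 0 \<and> q = 0 then 1 else p / q)"

fun Fv :: "ereal \<Rightarrow> ereal \<Rightarrow> (nat \<times> nat \<Rightarrow> real) \<Rightarrow> nat \<Rightarrow> nat \<Rightarrow> real" where
  "Fv a b x 0 k = (if k = 0 then 0 else 1)"
| "Fv a b x (Suc j) k =
     (if k = 0 then 0 else if 2 ^ Suc j \<le> k then 1
      else if even k then Fv a b x j (k div 2)
      else (let l = (k + 1) div 2; mu = (\<lambda>i. real_of_ereal (node a b x (Suc j + 1) i)) in
            Fv a b x j (l - 1) + (Fv a b x j l - Fv a b x j (l - 1))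
              * ratio0 (mu (4 * l - 1) - mu (4 * l - 2)) (mu (4 * l - 1) - mu (4 * l - 3))))"

definition dsba_w :: "ereal \<Rightarrow> ereal \<Rightarrow> nat \<Rightarrow> (nat \<times> nat \<Rightarrow> real) \<Rightarrow> nat \<Rightarrow> real" where
  "dsba_w a b n x l = Fv a b x n l - Fv a b x n (l - 1)"

definition dsba_theta :: "ereal \<Rightarrow> ereal \<Rightarrow> nat \<Rightarrow> (nat \<times> nat \<Rightarrow> real) \<Rightarrow> nat \<Rightarrow> real" where
  "dsba_theta a b n x l = real_of_ereal (node a b x (n + 1) (2 * l - 1))"

definition dsba_G :: "ereal \<Rightarrow> ereal \<Rightarrow> nat \<Rightarrow> (nat \<times> nat \<Rightarrow> real) \<times> (nat \<Rightarrow> real) \<Rightarrow> (real \<times> real) measure" where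
  "dsba_G a b n \<omega> = measure_of UNIV (sets borel)
     (\<lambda>A. \<Sum>l\<in>{1..2 ^ n}. ennreal (dsba_w a b n (fst \<omega>) l) * indicator A (dsba_theta a b n (fst \<omega>) l, snd \<omega> l))"

definition dsba_joint :: "ereal \<Rightarrow> ereal \<Rightarrow> (nat \<Rightarrow> nat \<Rightarrow> real measure) \<Rightarrow> real measure \<Rightarrow> nat
    \<Rightarrow> ((nat \<times> nat \<Rightarrow> real) \<times> (nat \<Rightarrow> real)) measure" where
  "dsba_joint a b H P n = locs a b H (Suc n) \<Otimes>\<^sub>M PiM {1..2 ^ n} (\<lambda>_. P)"

end

theory Submission
  imports Defs "HOL-Computational_Algebra.Polynomial"
begin

text \<open>
  For fixed test functions, a target \<open>Q\<close> is replaced by a finite mixture of point masses, whose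
  locations are then perturbed so that no barycenter of several of them hits an atom. For such a
  mixture, splitting intervals recursively at the barycenter of the atoms they contain isolates every
  atom after finitely many levels, and the ratio in the definition of \<open>F\<close> is exactly the one giving
  both halves their correct mass. Once an atom is isolated, all further nodes are placed close to
  it, so whatever the remaining weights are, the mass stays near the atom, and giving all descendants
  the mark of that atom reproduces the mixture.

  All nodes of this configuration are strictly ordered and interior, so the integrals of the test
  functions depend continuously on nodes and marks there, and a small box around the configuration
  consists of good outcomes. The box has positive probability because each conditional law
  dominates the unconditioned one on subsets of its gap.
\<close>

section \<open>Law of the location nodes\<close>

text \<open>The weights are functions of the locations: the ratio dividing the mass of an interval
  is read off its cut and the cuts of its two halves, so mass and position cannot be chosen
  separately. Barycenters reconcile them by the law of the lever: the barycenter of a union divides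
  the segment between the barycenters of its parts in inverse proportion to their masses, which is
  the required ratio. A cut falling on one of several atoms would leave that atom in neither open
  half; genericity excludes this. It also makes the locations distinct, so that a mark becomes a
  function of the location although target points with equal location may carry different marks. The
  barycenter of a single atom is the atom itself, so after isolation the two adjacent intervals
  contain no atom, and it is their position that remembers which atom they belong to. Every cut
  between several atoms leaves some on both sides, so as many levels as atoms suffice, and
  \<open>n\<close> is chosen as the number of atoms.\<close>

lemma finite_odd_idx [simp]: "finite (odd_idx j)"
  by (rule finite_subset[of _ "{..<2 ^ j}"]) (auto simp: odd_idx_def)

lemma finite_Lev [simp]: "finite (Lev j)"
  by (rule finite_subset[of _ "{..j} \<times> {..<2 ^ j}"])
    (auto simp: Lev_def odd_idx_def intro: less_le_trans power_increasing)

lemma Lev_0 [simp]: "Lev 0 = {}"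
  by (auto simp: Lev_def)

lemma Lev_Suc: "Lev (Suc j) = Lev j \<union> {Suc j} \<times> odd_idx (Suc j)"
  by (auto simp: Lev_def le_Suc_eq)

lemma Lev_Suc_cases:
  assumes "p \<in> Lev (Suc j)"
  obtains "p \<in> Lev j" "fst p \<noteq> Suc j" | k where "p = (Suc j, k)" "k \<in> odd_idx (Suc j)"
  using assms by (cases "fst p = Suc j") (auto simp: Lev_def)

lemma odd_idx_pos: "k \<in> odd_idx j \<Longrightarrow> 0 < k"
  by (auto simp: odd_idx_def elim: oddE)

lemma node_0 [simp]: "node a b x j 0 = a"
  by (cases j) auto

lemma node_top: "2 ^ j \<le> k \<Longrightarrow> node a b x j k = b"
  by (cases j) auto

lemma node_odd: "k \<in> odd_idx (Suc j) \<Longrightarrow> node a b x (Suc j) k = ereal (x (Suc j, k))"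
  by (auto simp: odd_idx_def elim: oddE)

lemma node_even: "node a b x (Suc j) (2 * k) = node a b x j k"
  by (cases "2 ^ j \<le> k") (auto simp: node_top)

lemma node_Suc_cases:
  fixes j k :: nat
  obtains "k = 0" | "2 ^ Suc j \<le> k" | k' where "k = 2 * k'" | "k \<in> odd_idx (Suc j)"
  unfolding odd_idx_def mem_Collect_eq by (metis evenE not_le)

lemma measurable_node:
  "j \<le> J \<Longrightarrow> (\<lambda>x. node a b x j k) \<in> borel_measurable (PiM (Lev J) (\<lambda>_. borel))"
proof (induction j arbitrary: k)
  case 0
  then show ?case by simp
next
  case (Suc j)
  show ?case
  proof (cases rule: node_Suc_cases[where j = j and k = k])
    case 1
    then show ?thesis by simp
  next
    case 2
    then show ?thesis by (subst node_top) auto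
  next
    case (3 k')
    with Suc show ?thesis by (simp only: node_even)
  next
    case 4
    moreover have "(Suc j, k) \<in> Lev J"
      using 4 Suc.prems by (auto simp: Lev_def)
    ultimately show ?thesis
      by (subst node_odd) (auto intro!: borel_measurable_ereal measurable_component_singleton)
  qed
qed

text \<open>Conditioning on a gap divides by a probability, which can only enlarge the mass of a
  subset of the gap. When the gap is null, so is the subset, and the convention for
  \<open>0 / 0\<close> does no harm.\<close>

lemma ennreal_le_divide_le_1:
  fixes x g :: ennreal
  assumes "x \<le> g" "g \<le> 1"
  shows "x \<le> x / g"
proof (cases "g = 0")
  case False
  moreover have "g \<noteq> top" using assms(2) by (metis ennreal_one_neq_top top_unique)
  ultimately have "x = (x / g) * g"
    by (simp add: ennreal_times_divide mult_divide_eq_ennreal mult.commute[of "x / g"] mult.commute[of g])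
  also have "\<dots> \<le> (x / g) * 1"
    using assms(2) by (rule mult_left_mono) simp
  finally show ?thesis by simp
qed (use assms in auto)

text \<open>\<open>product_sigma_finite\<close> asks for sigma-finiteness at every index, while the
  factors are controlled on \<open>I\<close> only. Null measures at the remaining indices repair
  this without changing the product over \<open>I\<close>.\<close>

lemma emeasure_PiM_finite:
  assumes "finite I" "\<And>i. i \<in> I \<Longrightarrow> sigma_finite_measure (M i)" "\<And>i. i \<in> I \<Longrightarrow> A i \<in> sets (M i)"
  shows "emeasure (PiM I M) (Pi\<^sub>E I A) = (\<Prod>i\<in>I. emeasure (M i) (A i))"
proof -
  let ?M = "\<lambda>i. if i \<in> I then M i else null_measure (M i)"
  interpret product_sigma_finite ?M
  proof (rule product_sigma_finite.intro)
    show "sigma_finite_measure (?M i)" for i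
      using assms(2) by (auto intro!: finite_measure.sigma_finite_measure finite_measureI)
  qed
  have "PiM I M = PiM I ?M"
    by (rule PiM_cong) auto
  then show ?thesis
    using assms by (simp add: emeasure_PiM)
qed

text \<open>The update map inside \<open>locs\<close>, under a name of its own because it must be
  measurable jointly in the old nodes \<open>x\<close> and the new draws \<open>y\<close>.\<close>

definition merge_level :: "nat \<Rightarrow> (nat \<times> nat \<Rightarrow> real) \<Rightarrow> (nat \<Rightarrow> real) \<Rightarrow> nat \<times> nat \<Rightarrow> real" where
  "merge_level j x y = (\<lambda>(i, k). if (i, k) \<in> Lev (Suc j) then (if i = Suc j then y k else x (i, k)) else undefined)"

lemma measurable_merge_level:
  "case_prod (merge_level j)
    \<in> PiM (Lev j) (\<lambda>_. borel) \<Otimes>\<^sub>M PiM (odd_idx (Suc j)) (\<lambda>_. borel) \<rightarrow>\<^sub>M PiM (Lev (Suc j)) (\<lambda>_. borel)"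
  unfolding case_prod_beta merge_level_def
proof (rule measurable_PiM_single')
  fix p assume "p \<in> Lev (Suc j)"
  then consider "p \<in> Lev j" "fst p \<noteq> Suc j" | k where "p = (Suc j, k)" "k \<in> odd_idx (Suc j)"
    by (rule Lev_Suc_cases)
  then show "(\<lambda>z. if (fst p, snd p) \<in> Lev (Suc j) then if fst p = Suc j then snd z (snd p) else fst z (fst p, snd p) else undefined)
      \<in> borel_measurable (PiM (Lev j) (\<lambda>_. borel) \<Otimes>\<^sub>M PiM (odd_idx (Suc j)) (\<lambda>_. borel))"
  proof cases
    case 1
    then show ?thesis by (auto simp: Lev_Suc)
  next
    case 2
    then show ?thesis by (auto simp: Lev_Suc)
  qed
qed (auto simp: space_PiM PiE_def extensional_def)

definition step_kernel where
  "step_kernel a b H j x =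
     distr (PiM (odd_idx (Suc j)) (\<lambda>k. uniform_measure (H (Suc j) k) (gap a b x j k)))
           (PiM (Lev (Suc j)) (\<lambda>_. borel)) (merge_level j x)"

text \<open>Closeness is required only at the coordinates in \<open>I\<close>, the others being left
  free. An eventual property yields at once a box of positive radius, which is the shape whose
  probability is estimated.\<close>

definition near :: "'i set \<Rightarrow> ('i \<Rightarrow> real) \<Rightarrow> ('i \<Rightarrow> real) filter" where
  "near I x0 = (INF \<delta>\<in>{0<..}. principal {x. \<forall>i\<in>I. \<bar>x i - x0 i\<bar> < \<delta>})"

lemma eventually_near:
  "eventually P (near I x0) \<longleftrightarrow> (\<exists>\<delta>>0. \<forall>x. (\<forall>i\<in>I. \<bar>x i - x0 i\<bar> < \<delta>) \<longrightarrow> P x)"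
  unfolding near_def
proof (subst eventually_INF_base)
  fix d e :: real assume "d \<in> {0<..}" "e \<in> {0<..}"
  then show "\<exists>c\<in>{0<..}. principal {x. \<forall>i\<in>I. \<bar>x i - x0 i\<bar> < c}
      \<le> inf (principal {x. \<forall>i\<in>I. \<bar>x i - x0 i\<bar> < d}) (principal {x. \<forall>i\<in>I. \<bar>x i - x0 i\<bar> < e})"
    by (intro bexI[of _ "min d e"]) auto
qed (auto simp: eventually_principal Bex_def)

lemma tendsto_near: "i \<in> I \<Longrightarrow> ((\<lambda>x. x i) \<longlongrightarrow> x0 i) (near I x0)"
  unfolding tendsto_iff eventually_near dist_real_def by auto

lemma tendsto_node_near:
  "j \<le> J \<Longrightarrow> ((\<lambda>x. node a b x j k) \<longlongrightarrow> node a b x0 j k) (near (Lev J) x0)"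
proof (induction j arbitrary: k)
  case 0
  then show ?case by simp
next
  case (Suc j)
  show ?case
  proof (cases rule: node_Suc_cases[where j = j and k = k])
    case 1
    then show ?thesis by simp
  next
    case 2
    then show ?thesis by (simp add: node_top del: node.simps)
  next
    case (3 k')
    with Suc show ?thesis by (simp only: node_even)
  next
    case 4
    moreover have "(Suc j, k) \<in> Lev J"
      using 4 Suc.prems by (auto simp: Lev_def)
    ultimately show ?thesis
      by (simp add: node_odd tendsto_near del: node.simps)
  qed
qed

section \<open>Transition kernels between levels and positive probability of boxes\<close>

context
  fixes a b :: ereal and H :: "nat \<Rightarrow> nat \<Rightarrow> real measure" and J :: nat
  assumes Hs: "\<And>j k. 1 \<le> j \<Longrightarrow> j \<le> J \<Longrightarrow> k \<in> odd_idx j \<Longrightarrow> sets (H j k) = sets borel"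
    and Hp: "\<And>j k. 1 \<le> j \<Longrightarrow> j \<le> J \<Longrightarrow> k \<in> odd_idx j \<Longrightarrow> prob_space (H j k)"
begin

lemma gap_sets [measurable]: "gap a b x j k \<in> sets borel"
  unfolding gap_def by measurable

text \<open>Only a sub-probability: a gap of measure zero turns \<open>uniform_measure\<close> into
  a measure of total mass zero, and nothing excludes such gaps for arbitrary
  \<open>x\<close>.\<close>

lemma subprob_uniform:
  assumes "j < J" "k \<in> odd_idx (Suc j)"
  shows "subprob_space (uniform_measure (H (Suc j) k) (gap a b x j k))"
proof -
  interpret prob_space "H (Suc j) k" using Hp assms by auto
  have s: "sets (H (Suc j) k) = sets borel" using Hs assms by auto
  have g: "gap a b x j k \<in> sets (H (Suc j) k)" by (simp add: s)
  show ?thesis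
  proof
    show "emeasure (uniform_measure (H (Suc j) k) (gap a b x j k))
        (space (uniform_measure (H (Suc j) k) (gap a b x j k))) \<le> 1"
      using g sets.sets_into_space[OF g] emeasure_finite[of "gap a b x j k"]
      by (cases "emeasure (H (Suc j) k) (gap a b x j k) = 0")
        (simp_all add: Int_absorb2 ennreal_divide_self less_top[symmetric])
    show "space (uniform_measure (H (Suc j) k) (gap a b x j k)) \<noteq> {}"
      by (simp add: not_empty)
  qed
qed

text \<open>The gap moves with \<open>x\<close>. Its mass is therefore viewed as the mass of a
  section of one measurable set of pairs, to which measurability of section masses applies.\<close>

lemma measurable_gap_emeasure:
  assumes "j < J" "k \<in> odd_idx (Suc j)" "A \<in> sets borel"
  shows "(\<lambda>x. emeasure (H (Suc j) k) (gap a b x j k \<inter> A)) \<in> borel_measurable (PiM (Lev j) (\<lambda>_. borel))"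
proof -
  interpret prob_space "H (Suc j) k" using Hp assms by auto
  have [measurable_cong]: "sets (H (Suc j) k) = sets borel" using Hs assms by auto
  note [measurable] = assms(3) measurable_node[OF order_refl, of a b j]
  let ?Q = "{z \<in> space (PiM (Lev j) (\<lambda>_. borel) \<Otimes>\<^sub>M H (Suc j) k).
       node a b (fst z) j ((k + 1) div 2 - 1) < ereal (snd z) \<and>
       ereal (snd z) \<le> node a b (fst z) j ((k + 1) div 2) \<and> snd z \<in> A}"
  have "?Q \<in> sets (PiM (Lev j) (\<lambda>_. borel) \<Otimes>\<^sub>M H (Suc j) k)"
    by measurable
  from measurable_emeasure_Pair[OF this] show ?thesis
  proof (rule measurable_cong[THEN iffD1, rotated])
    fix x assume "x \<in> space (PiM (Lev j) (\<lambda>_. borel :: real measure))"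
    then have "Pair x -` ?Q = gap a b x j k \<inter> A"
      using sets_eq_imp_space_eq[OF Hs[of "Suc j" k]] assms
      by (auto simp: gap_def space_pair_measure)
    then show "emeasure (H (Suc j) k) (Pair x -` ?Q) = emeasure (H (Suc j) k) (gap a b x j k \<inter> A)"
      by simp
  qed
qed

text \<open>Rectangles generate the product sigma-algebra and are stable under intersection, so it
  suffices to treat the masses of rectangles. These are finite products of quotients of gap
  masses.\<close>

lemma measurable_step_kernel:
  assumes "j < J"
  shows "step_kernel a b H j \<in> PiM (Lev j) (\<lambda>_. borel) \<rightarrow>\<^sub>M subprob_algebra (PiM (Lev (Suc j)) (\<lambda>_. borel))"
  unfolding step_kernel_def[abs_def]
proof (rule measurable_distr2[where M = "PiM (odd_idx (Suc j)) (\<lambda>_. borel)"])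
  let ?I = "odd_idx (Suc j)"
  let ?K = "\<lambda>x. PiM ?I (\<lambda>k. uniform_measure (H (Suc j) k) (gap a b x j k))"
  have s: "sets (uniform_measure (H (Suc j) k) (gap a b x j k)) = sets borel" if "k \<in> ?I" for k x
    using Hs assms that by auto
  \<comment> \<open>Intersecting the denominator with \<open>UNIV\<close> gives it the form of the
    numerator, so that \<open>measurable_gap_emeasure\<close> covers both.\<close>
  have em: "emeasure (?K x) (Pi\<^sub>E ?I A)
      = (\<Prod>k\<in>?I. emeasure (H (Suc j) k) (gap a b x j k \<inter> A k) / emeasure (H (Suc j) k) (gap a b x j k \<inter> UNIV))"
    if "\<And>k. k \<in> ?I \<Longrightarrow> A k \<in> sets borel" for A x
  proof -
    have "emeasure (?K x) (Pi\<^sub>E ?I A) = (\<Prod>k\<in>?I. emeasure (uniform_measure (H (Suc j) k) (gap a b x j k)) (A k))"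
      using that assms
      by (intro emeasure_PiM_finite)
       (auto simp: s Hs intro!: finite_measure.sigma_finite_measure subprob_space.axioms(1) subprob_uniform)
    also have "\<dots> = (\<Prod>k\<in>?I. emeasure (H (Suc j) k) (gap a b x j k \<inter> A k) / emeasure (H (Suc j) k) (gap a b x j k \<inter> UNIV))"
      using that assms by (intro prod.cong refl) (simp add: Hs)
    finally show ?thesis .
  qed
  have meas: "(\<lambda>x. emeasure (?K x) (Pi\<^sub>E ?I A)) \<in> borel_measurable (PiM (Lev j) (\<lambda>_. borel))"
    if "\<And>k. k \<in> ?I \<Longrightarrow> A k \<in> sets borel" for A
    using assms that
    by (subst em) (auto intro!: borel_measurable_prod_ennreal borel_measurable_divide_ennreal measurable_gap_emeasure
        measurable_gap_emeasure[where A = UNIV, simplified])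
  show "?K \<in> PiM (Lev j) (\<lambda>_. borel) \<rightarrow>\<^sub>M subprob_algebra (PiM ?I (\<lambda>_. borel))"
  proof (rule measurable_subprob_algebra_generated[OF sets_PiM])
    show "Int_stable (prod_algebra ?I (\<lambda>_. borel :: real measure))"
      by (rule Int_stable_prod_algebra)
    show "prod_algebra ?I (\<lambda>_. borel) \<subseteq> Pow (Pi\<^sub>E ?I (\<lambda>_. space (borel :: real measure)))"
      by (rule prod_algebra_sets_into_space)
    fix x
    show ss: "sets (?K x) = sets (PiM ?I (\<lambda>_. borel))"
      by (intro sets_PiM_cong refl s)
    show "subprob_space (?K x)"
    proof
      have sp: "space (?K x) = Pi\<^sub>E ?I (\<lambda>_. UNIV)"
        using sets_eq_imp_space_eq[OF ss] by (simp add: space_PiM)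
      show "space (?K x) \<noteq> {}" by (simp add: sp PiE_eq_empty_iff)
      have "emeasure (?K x) (space (?K x)) = (\<Prod>k\<in>?I. emeasure (uniform_measure (H (Suc j) k) (gap a b x j k)) UNIV)"
        unfolding sp using assms
        by (intro emeasure_PiM_finite)
         (auto simp: s Hs intro!: finite_measure.sigma_finite_measure subprob_space.axioms(1) subprob_uniform)
      also have "\<dots> \<le> (\<Prod>k\<in>?I. 1)"
        using assms by (intro prod_mono_ennreal subprob_space.subprob_emeasure_le_1 subprob_uniform)
      finally show "emeasure (?K x) (space (?K x)) \<le> 1" by simp
    qed
  next
    fix A assume "A \<in> prod_algebra ?I (\<lambda>_. borel :: real measure)"
    then obtain X where "A = Pi\<^sub>E ?I X" "\<And>k. k \<in> ?I \<Longrightarrow> X k \<in> sets borel"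
      by (auto simp: prod_algebra_eq_finite)
    then show "(\<lambda>x. emeasure (?K x) A) \<in> borel_measurable (PiM (Lev j) (\<lambda>_. borel))"
      using meas by auto
  next
    show "(\<lambda>x. emeasure (?K x) (Pi\<^sub>E ?I (\<lambda>_. space (borel :: real measure)))) \<in> borel_measurable (PiM (Lev j) (\<lambda>_. borel))"
      by (intro meas) auto
  qed
  show "case_prod (merge_level j) \<in> PiM (Lev j) (\<lambda>_. borel) \<Otimes>\<^sub>M PiM ?I (\<lambda>_. borel) \<rightarrow>\<^sub>M PiM (Lev (Suc j)) (\<lambda>_. borel)"
    by (rule measurable_merge_level)
qed

lemma sets_subprob_locs:
  "j \<le> J \<Longrightarrow> sets (locs a b H j) = sets (PiM (Lev j) (\<lambda>_. borel)) \<and> subprob_space (locs a b H j)"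
proof (induction j)
  case 0
  have "prob_space (PiM {} (\<lambda>_::nat \<times> nat. borel :: real measure))"
    by (rule prob_space_PiM) auto
  then show ?case by (simp add: prob_space_imp_subprob_space)
next
  case (Suc j)
  then interpret subprob_space "locs a b H j" by auto
  have k: "step_kernel a b H j \<in> locs a b H j \<rightarrow>\<^sub>M subprob_algebra (PiM (Lev (Suc j)) (\<lambda>_. borel))"
    using Suc measurable_step_kernel[of j] by (simp cong: measurable_cong_sets)
  have "locs a b H (Suc j) = locs a b H j \<bind> step_kernel a b H j"
    by (simp add: step_kernel_def[abs_def] merge_level_def[abs_def])
  then show ?case
    using sets_bind_measurable[OF k subprob_not_empty] subprob_space_bind[OF _ k] subprob_space_axioms
    by simp
qed


text \<open>The gaps move with the earlier nodes, so a lower bound uniform in these is needed.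
  Strict order at \<open>x0\<close> leaves room for fixed \<open>u k\<close> and \<open>v k\<close>
  that lie inside the gap for all earlier nodes close enough to \<open>x0\<close>. Between them sits
  the fixed window \<open>U k\<close>, and its unconditioned mass bounds its conditioned mass from
  below.\<close>

lemma emeasure_locs_box_pos:
  assumes H_full: "\<And>j k U. 1 \<le> j \<Longrightarrow> j \<le> J \<Longrightarrow> k \<in> odd_idx j \<Longrightarrow> open U \<Longrightarrow> U \<inter> Theta a b \<noteq> {} \<Longrightarrow> 0 < emeasure (H j k) U"
    and strict: "\<And>j k. j \<le> J \<Longrightarrow> k < 2 ^ j \<Longrightarrow> node a b x0 j k < node a b x0 j (Suc k)"
    and inTheta: "\<And>p. p \<in> Lev J \<Longrightarrow> x0 p \<in> Theta a b"
  shows "j \<le> J \<Longrightarrow> 0 < \<delta> \<Longrightarrow> 0 < emeasure (locs a b H j) (\<Pi>\<^sub>E p\<in>Lev j. {x0 p - \<delta><..<x0 p + \<delta>})"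
proof (induction j arbitrary: \<delta>)
  case 0
  have "prob_space (PiM {} (\<lambda>_::nat \<times> nat. borel :: real measure))"
    by (rule prob_space_PiM) auto
  from prob_space.emeasure_space_1[OF this] show ?case by (simp add: space_PiM)
next
  case (Suc j)
  let ?I = "odd_idx (Suc j)"
  let ?l = "\<lambda>k::nat. (k + 1) div 2"
  let ?B = "\<lambda>j \<delta>. \<Pi>\<^sub>E p\<in>Lev j. {x0 p - \<delta><..<x0 p + \<delta>}"
  have Bs: "?B j \<delta> \<in> sets (PiM (Lev j) (\<lambda>_. borel))" for j \<delta>
    by (rule sets_PiM_I_finite) auto
  have lt: "node a b x0 j (?l k - 1) < ereal (x0 (Suc j, k))" "ereal (x0 (Suc j, k)) < node a b x0 j (?l k)"
    if "k \<in> ?I" for k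
  proof -
    from that obtain m where k: "k = 2 * m + 1" and m: "k < 2 ^ Suc j"
      by (auto simp: odd_idx_def elim: oddE)
    have "node a b x0 (Suc j) (2 * m) < node a b x0 (Suc j) k"
      using strict[of "Suc j" "2 * m"] Suc.prems k m by simp
    then show "node a b x0 j (?l k - 1) < ereal (x0 (Suc j, k))"
      using that k by (simp add: node_even node_odd del: node.simps)
    have "node a b x0 (Suc j) k < node a b x0 (Suc j) (2 * Suc m)"
      using strict[of "Suc j" k] Suc.prems k m by simp
    then show "ereal (x0 (Suc j, k)) < node a b x0 j (?l k)"
      using that k by (simp only: node_even node_odd) simp
  qed
  have "\<exists>u. \<forall>k\<in>?I. node a b x0 j (?l k - 1) < ereal (u k) \<and> ereal (u k) < ereal (x0 (Suc j, k))"
    using ereal_dense2[OF lt(1)] by (intro bchoice) auto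
  then obtain u where u: "\<And>k. k \<in> ?I \<Longrightarrow> node a b x0 j (?l k - 1) < ereal (u k)"
    "\<And>k. k \<in> ?I \<Longrightarrow> u k < x0 (Suc j, k)" by auto
  have "\<exists>v. \<forall>k\<in>?I. ereal (x0 (Suc j, k)) < ereal (v k) \<and> ereal (v k) < node a b x0 j (?l k)"
    using ereal_dense2[OF lt(2)] by (intro bchoice) auto
  then obtain v where v: "\<And>k. k \<in> ?I \<Longrightarrow> ereal (v k) < node a b x0 j (?l k)"
    "\<And>k. k \<in> ?I \<Longrightarrow> x0 (Suc j, k) < v k" by auto
  have "eventually (\<lambda>x. \<forall>k\<in>?I. node a b x j (?l k - 1) < ereal (u k) \<and> ereal (v k) < node a b x j (?l k)) (near (Lev j) x0)"
    by (intro eventually_ball_finite finite_odd_idx ballI eventually_conj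
        order_tendstoD[OF tendsto_node_near[OF order_refl]] u v)
  then obtain \<delta>1 where d1: "0 < \<delta>1"
    "\<And>x k. \<forall>p\<in>Lev j. \<bar>x p - x0 p\<bar> < \<delta>1 \<Longrightarrow> k \<in> ?I \<Longrightarrow> node a b x j (?l k - 1) < ereal (u k) \<and> ereal (v k) < node a b x j (?l k)"
    unfolding eventually_near by blast
  \<comment> \<open>At most \<open>\<delta>\<close>, so that the earlier nodes stay in the required
    box, and at most \<open>\<delta>1\<close>, so that the gaps keep containing the windows.\<close>
  define \<delta>' where "\<delta>' = min \<delta> \<delta>1"
  define U where "U k = {max (u k) (x0 (Suc j, k) - \<delta>)<..<min (v k) (x0 (Suc j, k) + \<delta>)}" for k
  define c where "c = (\<Prod>k\<in>?I. emeasure (H (Suc j) k) (U k))"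
  have U_sets: "U k \<in> sets borel" for k by (simp add: U_def)
  have "0 < emeasure (H (Suc j) k) (U k)" if "k \<in> ?I" for k
  proof (rule H_full)
    have "x0 (Suc j, k) \<in> U k" using u v that Suc.prems by (auto simp: U_def)
    moreover have "x0 (Suc j, k) \<in> Theta a b" using that Suc.prems by (intro inTheta) (auto simp: Lev_def)
    ultimately show "U k \<inter> Theta a b \<noteq> {}" by auto
  qed (use that Suc.prems in \<open>auto simp: U_def\<close>)
  then have c_pos: "0 < c" unfolding c_def by (auto simp: zero_less_iff_neq_zero)
  have le: "c \<le> emeasure (step_kernel a b H j x) (?B (Suc j) \<delta>)" if x: "x \<in> ?B j \<delta>'" for x
  proof -
    let ?u = "\<lambda>k. uniform_measure (H (Suc j) k) (gap a b x j k)"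
    have xn: "\<forall>p\<in>Lev j. \<bar>x p - x0 p\<bar> < \<delta>1"
    proof
      fix p assume "p \<in> Lev j"
      then have "x p \<in> {x0 p - \<delta>'<..<x0 p + \<delta>'}" using x by (auto simp: PiE_iff)
      then show "\<bar>x p - x0 p\<bar> < \<delta>1" by (auto simp: \<delta>'_def abs_less_iff)
    qed
    have ug: "U k \<subseteq> gap a b x j k" if "k \<in> ?I" for k
    proof
      fix t assume "t \<in> U k"
      then have "u k < t" "t < v k" by (auto simp: U_def)
      with d1(2)[OF xn that] show "t \<in> gap a b x j k"
        unfolding gap_def by (auto intro: less_trans less_imp_le simp: less_ereal.simps(1)[symmetric] simp del: less_ereal.simps(1))
    qed
    have s: "sets (?u k) = sets borel" if "k \<in> ?I" for k
      using Hs Suc.prems that by auto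
    have ss: "sets (PiM ?I ?u) = sets (PiM ?I (\<lambda>_. borel))"
      by (intro sets_PiM_cong refl s)
    have mm: "merge_level j x \<in> PiM ?I ?u \<rightarrow>\<^sub>M PiM (Lev (Suc j)) (\<lambda>_. borel)"
    proof -
      have "x \<in> space (PiM (Lev j) (\<lambda>_. borel))" using x by (auto simp: space_PiM PiE_iff)
      from measurable_Pair2[OF measurable_merge_level this] show ?thesis
        using ss by (simp cong: measurable_cong_sets)
    qed
    have "c \<le> (\<Prod>k\<in>?I. emeasure (?u k) (U k))"
      unfolding c_def
    proof (rule prod_mono_ennreal)
      fix k assume k: "k \<in> ?I"
      interpret prob_space "H (Suc j) k" using Hp Suc.prems k by auto
      have "emeasure (?u k) (U k) = emeasure (H (Suc j) k) (U k) / emeasure (H (Suc j) k) (gap a b x j k)"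
        using k ug[OF k] Hs Suc.prems U_sets by (simp add: Int_absorb1)
      moreover have "emeasure (H (Suc j) k) (U k) \<le> emeasure (H (Suc j) k) (U k) / emeasure (H (Suc j) k) (gap a b x j k)"
        using k ug[OF k] Hs Suc.prems by (intro ennreal_le_divide_le_1 emeasure_mono emeasure_le_1) auto
      ultimately show "emeasure (H (Suc j) k) (U k) \<le> emeasure (?u k) (U k)" by simp
    qed
    also have "\<dots> = emeasure (PiM ?I ?u) (Pi\<^sub>E ?I U)"
      using Suc.prems
      by (intro emeasure_PiM_finite[symmetric])
       (auto simp: s Hs U_sets intro!: finite_measure.sigma_finite_measure subprob_space.axioms(1) subprob_uniform)
    also have "\<dots> \<le> emeasure (PiM ?I ?u) (merge_level j x -` ?B (Suc j) \<delta> \<inter> space (PiM ?I ?u))"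
    proof (rule emeasure_mono)
      show "Pi\<^sub>E ?I U \<subseteq> merge_level j x -` ?B (Suc j) \<delta> \<inter> space (PiM ?I ?u)"
      proof
        fix y assume y: "y \<in> Pi\<^sub>E ?I U"
        have "y \<in> space (PiM ?I ?u)" using y sets_eq_imp_space_eq[OF ss] by (auto simp: space_PiM PiE_iff)
        moreover have "merge_level j x y \<in> ?B (Suc j) \<delta>"
        proof (rule PiE_I)
          fix p assume "p \<in> Lev (Suc j)"
          then consider "p \<in> Lev j" "fst p \<noteq> Suc j" | k where "p = (Suc j, k)" "k \<in> ?I"
            by (rule Lev_Suc_cases)
          then show "merge_level j x y p \<in> {x0 p - \<delta><..<x0 p + \<delta>}"
          proof cases
            case 1
            then have "x p \<in> {x0 p - \<delta>'<..<x0 p + \<delta>'}" using x by (auto simp: PiE_iff)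
            then show ?thesis using 1 by (auto simp: merge_level_def Lev_Suc \<delta>'_def split: prod.splits)
          next
            case 2
            then have "y k \<in> U k" using y by (auto simp: PiE_iff)
            then show ?thesis using 2 by (auto simp: merge_level_def Lev_Suc U_def)
          qed
        qed (auto simp: merge_level_def split: prod.splits)
        ultimately show "y \<in> merge_level j x -` ?B (Suc j) \<delta> \<inter> space (PiM ?I ?u)" by auto
      qed
      show "merge_level j x -` ?B (Suc j) \<delta> \<inter> space (PiM ?I ?u) \<in> sets (PiM ?I ?u)"
        by (rule measurable_sets[OF mm Bs])
    qed
    also have "\<dots> = emeasure (step_kernel a b H j x) (?B (Suc j) \<delta>)"
      unfolding step_kernel_def by (rule emeasure_distr[OF mm Bs, symmetric])
    finally show ?thesis .
  qed
  have L: "sets (locs a b H j) = sets (PiM (Lev j) (\<lambda>_. borel))" "subprob_space (locs a b H j)"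
    using sets_subprob_locs[of j] Suc.prems by auto
  interpret subprob_space "locs a b H j" by (rule L)
  have k: "step_kernel a b H j \<in> locs a b H j \<rightarrow>\<^sub>M subprob_algebra (PiM (Lev (Suc j)) (\<lambda>_. borel))"
    using Suc.prems L measurable_step_kernel[of j] by (simp cong: measurable_cong_sets)
  have "0 < emeasure (locs a b H j) (?B j \<delta>')"
    using Suc.prems d1(1) by (intro Suc.IH) (auto simp: \<delta>'_def)
  then have "0 < c * emeasure (locs a b H j) (?B j \<delta>')"
    using c_pos by (simp add: ennreal_zero_less_mult_iff)
  also have "\<dots> = (\<integral>\<^sup>+x. c * indicator (?B j \<delta>') x \<partial>locs a b H j)"
    using Bs L by (simp add: nn_integral_cmult_indicator)
  also have "\<dots> \<le> (\<integral>\<^sup>+x. emeasure (step_kernel a b H j x) (?B (Suc j) \<delta>) \<partial>locs a b H j)"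
    using le by (intro nn_integral_mono) (auto split: split_indicator)
  also have "\<dots> = emeasure (locs a b H j \<bind> step_kernel a b H j) (?B (Suc j) \<delta>)"
    by (rule emeasure_bind[OF subprob_not_empty k Bs, symmetric])
  finally show ?case
    by (simp add: step_kernel_def[abs_def] merge_level_def[abs_def])
qed

end

section \<open>Weights and the random measure\<close>

lemma Fv_0 [simp]: "Fv a b x j 0 = 0"
  by (cases j) auto

lemma Fv_top: "2 ^ j \<le> k \<Longrightarrow> Fv a b x j k = 1"
  by (cases j; cases "k = 0") auto

lemma Fv_even: "Fv a b x (Suc j) (2 * k) = Fv a b x j k"
  by (cases "2 ^ j \<le> k"; cases "k = 0") (auto simp: Fv_top)

text \<open>Here \<open>l = Suc m\<close>, and the node with index \<open>4 * l - 2\<close> is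
  inherited from index \<open>2 * m + 1\<close> one level up. The ratio thus involves three drawn
  values: the cut of the interval and the cuts of its two halves.\<close>

lemma Fv_odd:
  assumes "m < 2 ^ j"
  shows "Fv a b x (Suc j) (2 * m + 1) = Fv a b x j m + (Fv a b x j (Suc m) - Fv a b x j m)
    * ratio0 (x (Suc (Suc j), 4 * m + 3) - x (Suc j, 2 * m + 1))
             (x (Suc (Suc j), 4 * m + 3) - x (Suc (Suc j), 4 * m + 1))"
proof -
  have n3: "node a b x (Suc (Suc j)) (4 * m + 3) = ereal (x (Suc (Suc j), 4 * m + 3))"
    and n1: "node a b x (Suc (Suc j)) (4 * m + 1) = ereal (x (Suc (Suc j), 4 * m + 1))"
    and n: "node a b x (Suc j) (2 * m + 1) = ereal (x (Suc j, 2 * m + 1))"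
    using assms by (auto intro!: node_odd simp: odd_idx_def simp del: node.simps)
  have n2: "node a b x (Suc (Suc j)) (4 * m + 2) = ereal (x (Suc j, 2 * m + 1))"
    using node_even[of a b x "Suc j" "2 * m + 1"] n by simp
  have idx: "(2 * m + 1 + 1) div 2 = Suc m" "Suc m - 1 = m" "4 * Suc m - 1 = 4 * m + 3"
    "4 * Suc m - 2 = 4 * m + 2" "4 * Suc m - 3 = 4 * m + 1" "Suc j + 1 = Suc (Suc j)"
    "(2 * m + 1 = 0) = False" "(2 ^ Suc j \<le> 2 * m + 1) = False" "even (2 * m + 1) = False"
    using assms by auto
  show ?thesis
    by (simp only: Fv.simps(2) Let_def idx if_False n1 n2 n3 real_of_ereal.simps)
qed

lemma dsba_theta_eq:
  assumes "l \<in> {1..2 ^ n}"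
  shows "dsba_theta a b n x l = x (Suc n, 2 * l - 1)" "(Suc n, 2 * l - 1) \<in> Lev (Suc n)"
proof -
  have "2 * l - 1 \<in> odd_idx (Suc n)"
    using assms by (auto simp: odd_idx_def)
  then show "dsba_theta a b n x l = x (Suc n, 2 * l - 1)" "(Suc n, 2 * l - 1) \<in> Lev (Suc n)"
    unfolding dsba_theta_def by (auto simp: node_odd Lev_def simp del: node.simps)
qed

lemma nat_Suc_cases:
  fixes j k :: nat
  obtains "2 ^ Suc j \<le> k" | m where "k = 2 * m" | m where "k = 2 * m + 1" "m < 2 ^ j"
proof (cases "even k")
  case True
  then show thesis using that(2) by (auto elim: evenE)
next
  case False
  then obtain m where "k = 2 * m + 1" by (elim oddE)
  then show thesis using that(1) that(3)[of m] by (cases "m < 2 ^ j") auto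
qed

lemma Lev_Fv:
  assumes "m < 2 ^ j" "Suc j < J"
  shows "(Suc j, 2 * m + 1) \<in> Lev J" "(Suc (Suc j), 4 * m + 1) \<in> Lev J" "(Suc (Suc j), 4 * m + 3) \<in> Lev J"
  using assms by (auto simp: Lev_def odd_idx_def)

text \<open>A value at a positive level \<open>j\<close> reads nodes of level \<open>Suc j\<close>,
  hence the strict bound \<open>j < J\<close>.\<close>

lemma measurable_Fv:
  "j < J \<Longrightarrow> (\<lambda>x. Fv a b x j k) \<in> borel_measurable (PiM (Lev J) (\<lambda>_. borel))"
proof (induction j arbitrary: k)
  case 0
  then show ?case by simp
next
  case (Suc j)
  show ?case
  proof (cases rule: nat_Suc_cases[where j = j and k = k])
    case 1
    then show ?thesis by (simp add: Fv_top del: Fv.simps)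
  next
    case (2 m)
    with Suc show ?thesis by (simp add: Fv_even del: Fv.simps)
  next
    case (3 m)
    have [measurable]: "(\<lambda>x. Fv a b x j i) \<in> borel_measurable (PiM (Lev J) (\<lambda>_. borel))" for i
      using Suc by simp
    have [measurable]: "(\<lambda>x. x (Suc j, 2 * m + 1)) \<in> borel_measurable (PiM (Lev J) (\<lambda>_. borel :: real measure))"
      "(\<lambda>x. x (Suc (Suc j), 4 * m + 1)) \<in> borel_measurable (PiM (Lev J) (\<lambda>_. borel :: real measure))"
      "(\<lambda>x. x (Suc (Suc j), 4 * m + 3)) \<in> borel_measurable (PiM (Lev J) (\<lambda>_. borel :: real measure))"
      by (intro measurable_component_singleton Lev_Fv[OF 3(2) Suc.prems])+
    show ?thesis
      unfolding 3(1) Fv_odd[OF 3(2)] ratio0_def by measurable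
  qed
qed

text \<open>The convention \<open>0 / 0 = 1\<close> makes \<open>ratio0\<close> discontinuous. Where
  the nodes of \<open>x0\<close> are strictly ordered the denominator is positive, hence positive
  nearby as well, and \<open>ratio0\<close> agrees there with an ordinary quotient.\<close>

lemma tendsto_Fv_near:
  assumes strict: "\<And>j m. Suc (Suc j) \<le> J \<Longrightarrow> m < 2 ^ j \<Longrightarrow> x0 (Suc (Suc j), 4 * m + 1) < x0 (Suc (Suc j), 4 * m + 3)"
  shows "j < J \<Longrightarrow> ((\<lambda>x. Fv a b x j k) \<longlongrightarrow> Fv a b x0 j k) (near (Lev J) x0)"
proof (induction j arbitrary: k)
  case 0
  then show ?case by simp
next
  case (Suc j)
  show ?case
  proof (cases rule: nat_Suc_cases[where j = j and k = k])
    case 1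
    then show ?thesis by (simp add: Fv_top del: Fv.simps)
  next
    case (2 m)
    with Suc show ?thesis by (simp add: Fv_even del: Fv.simps)
  next
    case (3 m)
    let ?d = "\<lambda>x. x (Suc (Suc j), 4 * m + 3) - x (Suc (Suc j), 4 * m + 1) :: real"
    let ?e = "\<lambda>x. x (Suc (Suc j), 4 * m + 3) - x (Suc j, 2 * m + 1) :: real"
    have t: "((\<lambda>x. x (Suc j, 2 * m + 1)) \<longlongrightarrow> x0 (Suc j, 2 * m + 1)) (near (Lev J) x0)"
      "((\<lambda>x. x (Suc (Suc j), 4 * m + 1)) \<longlongrightarrow> x0 (Suc (Suc j), 4 * m + 1)) (near (Lev J) x0)"
      "((\<lambda>x. x (Suc (Suc j), 4 * m + 3)) \<longlongrightarrow> x0 (Suc (Suc j), 4 * m + 3)) (near (Lev J) x0)"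
      by (intro tendsto_near Lev_Fv[OF 3(2) Suc.prems])+
    have pos: "0 < ?d x0"
      using strict[of j m] 3 Suc.prems by simp
    have td: "(?d \<longlongrightarrow> ?d x0) (near (Lev J) x0)" and te: "(?e \<longlongrightarrow> ?e x0) (near (Lev J) x0)"
      by (intro tendsto_intros t)+
    have "((\<lambda>x. ratio0 (?e x) (?d x)) \<longlongrightarrow> ?e x0 / ?d x0) (near (Lev J) x0)"
    proof (rule Lim_transform_eventually)
      show "((\<lambda>x. ?e x / ?d x) \<longlongrightarrow> ?e x0 / ?d x0) (near (Lev J) x0)"
        using pos by (intro tendsto_divide td te) simp
      show "eventually (\<lambda>x. ?e x / ?d x = ratio0 (?e x) (?d x)) (near (Lev J) x0)"
        using order_tendstoD(1)[OF td pos] by eventually_elim (simp add: ratio0_def)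
    qed
    moreover have "ratio0 (?e x0) (?d x0) = ?e x0 / ?d x0"
      using pos by (simp add: ratio0_def)
    ultimately have "((\<lambda>x. ratio0 (?e x) (?d x)) \<longlongrightarrow> ratio0 (?e x0) (?d x0)) (near (Lev J) x0)"
      by simp
    moreover have "((\<lambda>x. Fv a b x j i) \<longlongrightarrow> Fv a b x0 j i) (near (Lev J) x0)" for i
      using Suc by simp
    ultimately show ?thesis
      unfolding 3(1) Fv_odd[OF 3(2)] by (intro tendsto_add tendsto_diff tendsto_mult)
  qed
qed

text \<open>The \<open>max 0\<close> appears because \<open>dsba_G\<close> is built from \<open>ennreal\<close>, which truncates negative weights.\<close>

lemma integral_dsba_G:
  fixes f :: "real \<times> real \<Rightarrow> real"
  assumes f: "f \<in> borel_measurable borel"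
  shows "(\<integral>z. f z \<partial>dsba_G a b n \<omega>)
    = (\<Sum>l\<in>{1..2 ^ n}. max 0 (dsba_w a b n (fst \<omega>) l) * f (dsba_theta a b n (fst \<omega>) l, snd \<omega> l))"
proof -
  let ?I = "{1..2 ^ n} :: nat set"
  let ?w = "\<lambda>l. dsba_w a b n (fst \<omega>) l"
  let ?z = "\<lambda>l. (dsba_theta a b n (fst \<omega>) l, snd \<omega> l)"
  let ?D = "density (count_space ?I) (\<lambda>l. ennreal (max 0 (?w l)))"
  let ?M = "distr ?D borel ?z"
  have "emeasure ?M A = (\<Sum>l\<in>?I. ennreal (?w l) * indicator A (?z l))" if "A \<in> sets borel" for A
  proof -
    have "emeasure ?M A = emeasure ?D (?z -` A \<inter> ?I)"
      using that by (subst emeasure_distr) auto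
    also have "\<dots> = (\<integral>\<^sup>+l. ennreal (max 0 (?w l)) * indicator (?z -` A \<inter> ?I) l \<partial>count_space ?I)"
      by (rule emeasure_density) auto
    also have "\<dots> = (\<Sum>l\<in>?I. ennreal (max 0 (?w l)) * indicator (?z -` A \<inter> ?I) l)"
      by (rule nn_integral_count_space_finite) simp
    also have "\<dots> = (\<Sum>l\<in>?I. ennreal (?w l) * indicator A (?z l))"
      by (intro sum.cong refl) (auto split: split_indicator simp: max_def ennreal_neg)
    finally show ?thesis .
  qed
  moreover have "sigma_sets UNIV (sets borel) = sets (borel :: (real \<times> real) measure)"
    using sets.sigma_sets_eq[of "borel :: (real \<times> real) measure"] by simp
  ultimately have "dsba_G a b n \<omega> = measure_of UNIV (sets borel) (emeasure ?M)"
    unfolding dsba_G_def by (intro measure_of_eq) auto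
  also have "\<dots> = ?M"
    using measure_of_of_measure[of ?M] by simp
  finally have "(\<integral>z. f z \<partial>dsba_G a b n \<omega>) = (\<integral>l. f (?z l) \<partial>?D)"
    using f by (simp add: integral_distr)
  also have "\<dots> = (\<integral>l. max 0 (?w l) * f (?z l) \<partial>count_space ?I)"
    by (rule integral_real_density) auto
  also have "\<dots> = (\<Sum>l\<in>?I. max 0 (?w l) * f (?z l))"
    by (rule lebesgue_integral_count_space_finite) simp
  finally show ?thesis .
qed

section \<open>From one good configuration to an event of positive probability\<close>

lemma prod_ennreal_pos:
  fixes f :: "'i \<Rightarrow> ennreal"
  shows "(\<And>i. i \<in> I \<Longrightarrow> 0 < f i) \<Longrightarrow> 0 < prod f I"
  by (induction I rule: infinite_finite_induct) (auto simp: ennreal_zero_less_mult_iff)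

text \<open>The test functions are continuous on \<open>Theta a b \<times> {0..}\<close> only.
  Locations strictly between \<open>a\<close> and \<open>b\<close> stay in \<open>Theta a b\<close>
  under small changes, but a mark may be \<open>0\<close>, so marks are varied within the half-line.
  As \<open>P\<close> gives no mass to negative numbers, the box of marks loses no probability by
  being cut down to it.\<close>

lemma dsba_event_pos:
  fixes f :: "nat \<Rightarrow> real \<times> real \<Rightarrow> real"
  assumes Hs: "\<And>j k. 1 \<le> j \<Longrightarrow> j \<le> Suc n \<Longrightarrow> k \<in> odd_idx j \<Longrightarrow> sets (H j k) = sets borel"
    and Hp: "\<And>j k. 1 \<le> j \<Longrightarrow> j \<le> Suc n \<Longrightarrow> k \<in> odd_idx j \<Longrightarrow> prob_space (H j k)"
    and H_full: "\<And>j k U. 1 \<le> j \<Longrightarrow> j \<le> Suc n \<Longrightarrow> k \<in> odd_idx j \<Longrightarrow> open U \<Longrightarrow> U \<inter> Theta a b \<noteq> {} \<Longrightarrow> 0 < emeasure (H j k) U"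
    and P: "sets P = sets borel" "prob_space P" "emeasure P {..<0} = 0"
    and P_full: "\<And>U. open U \<Longrightarrow> U \<inter> {0..} \<noteq> {} \<Longrightarrow> 0 < emeasure P U"
    and strict: "\<And>j k. j \<le> Suc n \<Longrightarrow> k < 2 ^ j \<Longrightarrow> node a b x0 j k < node a b x0 j (Suc k)"
    and inside: "\<And>p. p \<in> Lev (Suc n) \<Longrightarrow> a < ereal (x0 p) \<and> ereal (x0 p) < b"
    and y0: "\<And>l. l \<in> {1..2 ^ n} \<Longrightarrow> 0 \<le> y0 l"
    and f: "\<And>i. i < K \<Longrightarrow> f i \<in> borel_measurable borel" "\<And>i. i < K \<Longrightarrow> continuous_on (Theta a b \<times> {0..}) (f i)"
    and close: "\<And>i. i < K \<Longrightarrow>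
      \<bar>(\<Sum>l\<in>{1..2 ^ n}. max 0 (dsba_w a b n x0 l) * f i (dsba_theta a b n x0 l, y0 l)) - c i\<bar> < \<epsilon>"
  shows "0 < emeasure (dsba_joint a b H P n)
    {\<omega> \<in> space (dsba_joint a b H P n). \<forall>i<K. \<bar>(\<integral>z. f i z \<partial>dsba_G a b n \<omega>) - c i\<bar> < \<epsilon>}"
proof -
  let ?J = "dsba_joint a b H P n" and ?I = "{1..2 ^ n} :: nat set"
  \<comment> \<open>A finite sum in place of the integral against a random measure turns
    measurability and continuity into questions about real functions.\<close>
  define S where "S i \<omega> = (\<Sum>l\<in>?I. max 0 (dsba_w a b n (fst \<omega>) l) * f i (dsba_theta a b n (fst \<omega>) l, snd \<omega> l))" for i \<omega>
  have L: "sets (locs a b H (Suc n)) = sets (PiM (Lev (Suc n)) (\<lambda>_. borel))" "subprob_space (locs a b H (Suc n))"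
    using sets_subprob_locs[of "Suc n" H "Suc n" a b] Hs Hp by blast+
  have PI: "sets (PiM ?I (\<lambda>_. P)) = sets (PiM ?I (\<lambda>_. borel))"
    by (intro sets_PiM_cong refl P(1))
  have Js: "sets ?J = sets (PiM (Lev (Suc n)) (\<lambda>_. borel) \<Otimes>\<^sub>M PiM ?I (\<lambda>_. borel))"
    unfolding dsba_joint_def by (intro sets_pair_measure_cong L PI)
  have S_meas: "S i \<in> borel_measurable ?J" if "i < K" for i
  proof -
    note [measurable] = f(1)[OF that]
    have [measurable]: "(\<lambda>x. dsba_w a b n x l) \<in> borel_measurable (PiM (Lev (Suc n)) (\<lambda>_. borel))" for l
      unfolding dsba_w_def by (intro borel_measurable_diff measurable_Fv) auto
    have [measurable]: "(\<lambda>x. dsba_theta a b n x l) \<in> borel_measurable (PiM (Lev (Suc n)) (\<lambda>_. borel))" for l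
      unfolding dsba_theta_def
      by (intro borel_measurable_real_of_ereal measurable_node) auto
    have "S i \<in> borel_measurable (PiM (Lev (Suc n)) (\<lambda>_. borel) \<Otimes>\<^sub>M PiM ?I (\<lambda>_. borel))"
      unfolding S_def
    proof (rule borel_measurable_sum)
      fix l assume [measurable]: "l \<in> ?I"
      show "(\<lambda>\<omega>. max 0 (dsba_w a b n (fst \<omega>) l) * f i (dsba_theta a b n (fst \<omega>) l, snd \<omega> l))
        \<in> borel_measurable (PiM (Lev (Suc n)) (\<lambda>_. borel) \<Otimes>\<^sub>M PiM ?I (\<lambda>_. borel))"
        by measurable
    qed
    then show ?thesis using Js by (simp cong: measurable_cong_sets)
  qed
  let ?E = "{\<omega> \<in> space ?J. \<forall>i<K. \<bar>S i \<omega> - c i\<bar> < \<epsilon>}"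
  have E: "{\<omega> \<in> space ?J. \<forall>i<K. \<bar>(\<integral>z. f i z \<partial>dsba_G a b n \<omega>) - c i\<bar> < \<epsilon>} = ?E"
    using f(1) by (auto simp: S_def integral_dsba_G)
  have E_sets: "?E \<in> sets ?J"
  proof -
    have "{\<omega> \<in> space ?J. \<bar>S i \<omega> - c i\<bar> < \<epsilon>} \<in> sets ?J" if "i < K" for i
      by (intro borel_measurable_less borel_measurable_abs borel_measurable_diff borel_measurable_const S_meas that)
    then have "{\<omega> \<in> space ?J. \<forall>i\<in>{..<K}. \<bar>S i \<omega> - c i\<bar> < \<epsilon>} \<in> sets ?J"
      by (intro sets.sets_Collect_finite_All finite_lessThan) (simp only: lessThan_iff)
    then show ?thesis by (simp only: lessThan_iff Ball_def)
  qed
  let ?X = "near (Lev (Suc n)) x0" and ?N = "{y. \<forall>l\<in>?I. 0 \<le> y l}"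
  let ?Y = "inf (near ?I y0) (principal ?N)"
  have strict': "x0 (Suc (Suc j), 4 * m + 1) < x0 (Suc (Suc j), 4 * m + 3)"
    if "Suc (Suc j) \<le> Suc n" "m < 2 ^ j" for j m
  proof -
    have "node a b x0 (Suc (Suc j)) (4 * m + 1) < node a b x0 (Suc (Suc j)) (Suc (4 * m + 1))"
      "node a b x0 (Suc (Suc j)) (Suc (4 * m + 1)) < node a b x0 (Suc (Suc j)) (Suc (Suc (4 * m + 1)))"
      using that by (auto intro!: strict simp del: node.simps)
    then have "node a b x0 (Suc (Suc j)) (4 * m + 1) < node a b x0 (Suc (Suc j)) (4 * m + 3)"
      by (simp add: eval_nat_numeral del: node.simps)
    moreover have "4 * m + 1 \<in> odd_idx (Suc (Suc j))" "4 * m + 3 \<in> odd_idx (Suc (Suc j))"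
      using that by (auto simp: odd_idx_def)
    ultimately show ?thesis by (simp only: node_odd) simp
  qed
  have tendS: "((\<lambda>\<omega>. S i \<omega>) \<longlongrightarrow> S i (x0, y0)) (?X \<times>\<^sub>F ?Y)" if i: "i < K" for i
    unfolding S_def
  proof (intro tendsto_sum tendsto_mult tendsto_max tendsto_const)
    fix l assume l: "l \<in> ?I"
    have fst: "filterlim fst ?X (?X \<times>\<^sub>F ?Y)" and snd: "filterlim snd ?Y (?X \<times>\<^sub>F ?Y)"
      by (rule filterlim_fst filterlim_snd)+
    show "((\<lambda>\<omega>. dsba_w a b n (fst \<omega>) l) \<longlongrightarrow> dsba_w a b n (fst (x0, y0)) l) (?X \<times>\<^sub>F ?Y)"
      unfolding dsba_w_def fst_conv
      by (intro tendsto_diff filterlim_compose[OF tendsto_Fv_near[OF strict' lessI] fst])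
    have th: "((\<lambda>\<omega>. dsba_theta a b n (fst \<omega>) l) \<longlongrightarrow> dsba_theta a b n x0 l) (?X \<times>\<^sub>F ?Y)"
      unfolding dsba_theta_eq(1)[OF l]
      by (rule filterlim_compose[OF tendsto_near[OF dsba_theta_eq(2)[OF l]] fst])
    have "((\<lambda>y. y l) \<longlongrightarrow> y0 l) ?Y"
      by (rule tendsto_mono[OF inf_le1 tendsto_near[OF l]])
    then have ph: "((\<lambda>\<omega>. snd \<omega> l) \<longlongrightarrow> y0 l) (?X \<times>\<^sub>F ?Y)"
      by (rule filterlim_compose[OF _ snd])
    have ins: "a < ereal (dsba_theta a b n x0 l)" "ereal (dsba_theta a b n x0 l) < b"
      using inside[OF dsba_theta_eq(2)[OF l]] dsba_theta_eq(1)[OF l] by auto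
    have "eventually (\<lambda>\<omega>. a < ereal (dsba_theta a b n (fst \<omega>) l) \<and> ereal (dsba_theta a b n (fst \<omega>) l) < b) (?X \<times>\<^sub>F ?Y)"
      by (intro eventually_conj order_tendstoD[OF tendsto_ereal[OF th]] ins)
    moreover have "eventually (\<lambda>y. 0 \<le> y l) ?Y"
      using l by (auto simp: eventually_inf_principal)
    then have "eventually (\<lambda>\<omega>. 0 \<le> snd \<omega> l) (?X \<times>\<^sub>F ?Y)"
      using snd by (rule eventually_compose_filterlim)
    ultimately have ev: "eventually (\<lambda>\<omega>. (dsba_theta a b n (fst \<omega>) l, snd \<omega> l) \<in> Theta a b \<times> {0..}) (?X \<times>\<^sub>F ?Y)"
      by eventually_elim (auto simp: Theta_def)
    show "((\<lambda>\<omega>. f i (dsba_theta a b n (fst \<omega>) l, snd \<omega> l)) \<longlongrightarrow> f i (dsba_theta a b n (fst (x0, y0)) l, snd (x0, y0) l)) (?X \<times>\<^sub>F ?Y)"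
      unfolding fst_conv snd_conv
    proof (rule continuous_on_tendsto_compose[OF f(2)[OF i] tendsto_Pair[OF th ph] _ ev])
      show "(dsba_theta a b n x0 l, y0 l) \<in> Theta a b \<times> {0..}"
        using ins y0[OF l] by (auto simp: Theta_def)
    qed
  qed
  have "eventually (\<lambda>\<omega>. \<forall>i\<in>{..<K}. \<bar>S i \<omega> - c i\<bar> < \<epsilon>) (?X \<times>\<^sub>F ?Y)"
  proof (intro eventually_ball_finite ballI)
    fix i assume "i \<in> {..<K}"
    then have i: "i < K" by simp
    have "((\<lambda>\<omega>. \<bar>S i \<omega> - c i\<bar>) \<longlongrightarrow> \<bar>S i (x0, y0) - c i\<bar>) (?X \<times>\<^sub>F ?Y)"
      by (intro tendsto_rabs tendsto_diff tendsto_const tendS i)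
    moreover have "\<bar>S i (x0, y0) - c i\<bar> < \<epsilon>"
      using close[OF i] by (simp add: S_def)
    ultimately show "eventually (\<lambda>\<omega>. \<bar>S i \<omega> - c i\<bar> < \<epsilon>) (?X \<times>\<^sub>F ?Y)"
      by (rule order_tendstoD)
  qed simp
  then obtain A B where AB: "eventually A ?X" "eventually B ?Y"
    "\<And>x y. A x \<Longrightarrow> B y \<Longrightarrow> \<forall>i<K. \<bar>S i (x, y) - c i\<bar> < \<epsilon>"
    unfolding eventually_prod_filter by auto
  from AB(1) obtain d where d: "0 < d" "\<And>x. \<forall>p\<in>Lev (Suc n). \<bar>x p - x0 p\<bar> < d \<Longrightarrow> A x"
    unfolding eventually_near by blast
  from AB(2) obtain e where e: "0 < e" "\<And>y. \<forall>l\<in>?I. \<bar>y l - y0 l\<bar> < e \<Longrightarrow> \<forall>l\<in>?I. 0 \<le> y l \<Longrightarrow> B y"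
    unfolding eventually_inf_principal eventually_near by blast
  let ?BX = "\<Pi>\<^sub>E p\<in>Lev (Suc n). {x0 p - d<..<x0 p + d}"
  let ?V = "\<lambda>l. {y0 l - e<..<y0 l + e} - {..<0}"
  let ?BY = "\<Pi>\<^sub>E l\<in>?I. ?V l"
  have sX: "?BX \<in> sets (locs a b H (Suc n))"
    unfolding L by (rule sets_PiM_I_finite) auto
  have sY: "?BY \<in> sets (PiM ?I (\<lambda>_. P))"
    by (rule sets_PiM_I_finite) (auto simp: P)
  have "0 < emeasure (locs a b H (Suc n)) ?BX"
  proof (rule emeasure_locs_box_pos[where J = "Suc n"])
    fix p assume "p \<in> Lev (Suc n)"
    then show "x0 p \<in> Theta a b" using inside by (auto simp: Theta_def less_imp_le)
  qed (use Hs Hp H_full strict d in \<open>auto simp del: node.simps locs.simps\<close>)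
  moreover have "0 < emeasure (PiM ?I (\<lambda>_. P)) ?BY"
  proof -
    interpret P: prob_space P by (rule P)
    have "0 < emeasure P (?V l)" if "l \<in> ?I" for l
    proof -
      have "emeasure P (?V l) = emeasure P {y0 l - e<..<y0 l + e}"
        using P by (intro emeasure_Diff_null_set) (auto simp: null_sets_def)
      also have "0 < \<dots>"
      proof (rule P_full)
        have "y0 l \<in> {y0 l - e<..<y0 l + e} \<inter> {0..}"
          using y0[OF that] e(1) by simp
        then show "{y0 l - e<..<y0 l + e} \<inter> {0..} \<noteq> {}" by blast
      qed simp
      finally show ?thesis .
    qed
    moreover have "emeasure (PiM ?I (\<lambda>_. P)) ?BY = (\<Prod>l\<in>?I. emeasure P (?V l))"
      by (rule emeasure_PiM_finite) (auto simp: P P.sigma_finite_measure_axioms)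
    ultimately show ?thesis
      by (simp only: prod_ennreal_pos)
  qed
  moreover have "emeasure ?J (?BX \<times> ?BY) = emeasure (locs a b H (Suc n)) ?BX * emeasure (PiM ?I (\<lambda>_. P)) ?BY"
  proof -
    interpret prob_space "PiM ?I (\<lambda>_. P)"
      using P by (intro prob_space_PiM)
    show ?thesis
      unfolding dsba_joint_def by (rule emeasure_pair_measure_Times[OF sX sY])
  qed
  ultimately have "0 < emeasure ?J (?BX \<times> ?BY)"
    by (simp only: ennreal_zero_less_mult_iff)
  also have "\<dots> \<le> emeasure ?J ?E"
  proof (rule emeasure_mono[OF _ E_sets])
    show "?BX \<times> ?BY \<subseteq> ?E"
    proof clarify
      fix x y assume x: "x \<in> ?BX" and y: "y \<in> ?BY"
      have "(x, y) \<in> space ?J"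
        using sets.sets_into_space[OF sX] sets.sets_into_space[OF sY] x y
        by (auto simp: dsba_joint_def space_pair_measure simp del: locs.simps)
      moreover have "A x"
        using x by (intro d) (auto simp: PiE_iff abs_less_iff algebra_simps)
      moreover have "B y"
        using y by (intro e) (auto simp: PiE_iff abs_less_iff algebra_simps)
      ultimately show "(x, y) \<in> space ?J \<and> (\<forall>i<K. \<bar>S i (x, y) - c i\<bar> < \<epsilon>)"
        using AB(3) by auto
    qed
  qed
  finally show ?thesis unfolding E .
qed

section \<open>Barycentric trees of finite distributions\<close>

definition barycenter :: "(real \<Rightarrow> real) \<Rightarrow> real set \<Rightarrow> real" where
  "barycenter p U = (\<Sum>u\<in>U. p u * u) / (\<Sum>u\<in>U. p u)"

lemma barycenter_singleton [simp]: "p t \<noteq> 0 \<Longrightarrow> barycenter p {t} = t"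
  by (simp add: barycenter_def)

text \<open>The weighted deviations from the barycenter add up to zero. With at least two points
  some deviation is nonzero, and since all weights are positive both signs must occur.\<close>

lemma barycenter_strict_bounds:
  assumes "finite U" "\<And>u. u \<in> U \<Longrightarrow> 0 < p u" "1 < card U"
  shows "\<exists>u\<in>U. u < barycenter p U" "\<exists>u\<in>U. barycenter p U < u"
proof -
  let ?m = "barycenter p U"
  from assms(3) obtain v where v: "v \<in> U" "v \<noteq> ?m"
    by (metis One_nat_def card_1_singleton_iff card.empty less_irrefl not_less_zero
        is_singletonI' is_singleton_altdef less_nat_zero_code)
  have "0 < sum p U"
    using v(1) assms by (intro sum_pos) auto
  then have "(\<Sum>u\<in>U. p u * u) = sum p U * ?m"
    by (simp add: barycenter_def)
  then have 0: "(\<Sum>u\<in>U. p u * (u - ?m)) = 0"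
    by (simp add: right_diff_distrib sum_subtractf sum_distrib_right[symmetric])
  have nz: "p v * (v - ?m) \<noteq> 0" using v assms(2)[OF v(1)] by simp
  show "\<exists>u\<in>U. u < ?m"
  proof (rule ccontr)
    assume "\<not> ?thesis"
    then have "\<And>u. u \<in> U \<Longrightarrow> 0 \<le> p u * (u - ?m)"
      using assms(2) by (simp add: not_less less_imp_le)
    with 0 nz v(1) assms(1) show False
      using sum_nonneg_eq_0_iff[of U "\<lambda>u. p u * (u - ?m)"] by auto
  qed
  show "\<exists>u\<in>U. ?m < u"
  proof (rule ccontr)
    assume "\<not> ?thesis"
    then have "\<And>u. u \<in> U \<Longrightarrow> 0 \<le> - (p u * (u - ?m))"
      using assms(2) by (simp add: not_less less_imp_le mult_nonneg_nonpos)
    moreover have "(\<Sum>u\<in>U. - (p u * (u - ?m))) = 0" using 0 by (simp add: sum_negf)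
    ultimately show False
      using nz v(1) assms(1) sum_nonneg_eq_0_iff[of U "\<lambda>u. - (p u * (u - ?m))"] by auto
  qed
qed

text \<open>Law of the lever: if \<open>V\<close> has mass \<open>s\<close> and \<open>W\<close> has
  mass \<open>t\<close>, the barycenter of the union is the convex combination of the two
  barycenters with weights \<open>s / (s + t)\<close> and \<open>t / (s + t)\<close>. The left-hand
  side is the ratio in \<open>Fv_odd\<close>, evaluated at barycenters.\<close>

lemma barycenter_union_ratio:
  assumes fin: "finite V" "finite W" and disj: "V \<inter> W = {}"
    and pos: "0 < sum p V" "0 < sum p W" and ne: "barycenter p V \<noteq> barycenter p W"
  shows "(barycenter p W - barycenter p (V \<union> W)) / (barycenter p W - barycenter p V) = sum p V / sum p (V \<union> W)"
proof -
  let ?s = "sum p V" and ?t = "sum p W" and ?v = "barycenter p V" and ?w = "barycenter p W"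
  have "(\<Sum>u\<in>V. p u * u) = ?v * ?s" "(\<Sum>u\<in>W. p u * u) = ?w * ?t"
    using pos by (auto simp: barycenter_def)
  then have m: "barycenter p (V \<union> W) = (?v * ?s + ?w * ?t) / (?s + ?t)"
    using fin disj by (simp add: barycenter_def sum.union_disjoint)
  have "?w - (?v * ?s + ?w * ?t) / (?s + ?t) = (?w - ?v) * (?s / (?s + ?t))"
    using pos by (simp add: field_simps)
  with ne fin disj show ?thesis
    unfolding m by (simp add: sum.union_disjoint)
qed

text \<open>\<open>sep\<close> is a quantitative form of genericity. For \<open>U = {t'}\<close> it
  keeps atoms at distance \<open>\<delta>\<close> from each other; for larger \<open>U\<close> it
  keeps every cut between several atoms at distance \<open>\<delta>\<close> from all atoms.
  \<open>margin\<close> does the same for the end points.\<close>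

locale separated_atoms =
  fixes a b :: ereal and T :: "real set" and p :: "real \<Rightarrow> real" and \<delta> :: real
  assumes fin: "finite T" and ne: "T \<noteq> {}" and pos: "\<And>t. t \<in> T \<Longrightarrow> 0 < p t"
    and sum1: "sum p T = 1" and \<delta>: "0 < \<delta>"
    and margin: "\<And>t. t \<in> T \<Longrightarrow> a \<le> ereal (t - \<delta>) \<and> ereal (t + \<delta>) \<le> b"
    and sep: "\<And>U t. U \<subseteq> T \<Longrightarrow> U \<noteq> {} \<Longrightarrow> t \<in> T \<Longrightarrow> U \<noteq> {t} \<Longrightarrow> \<delta> \<le> \<bar>barycenter p U - t\<bar>"
begin

section \<open>Splitting one interval\<close>

definition atoms :: "ereal \<Rightarrow> ereal \<Rightarrow> real set" where
  "atoms A B = {t \<in> T. A < ereal t \<and> ereal t < B}"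

text \<open>An interval without atoms only arises next to an atom that has already been isolated. There
  any point close to that atom may be drawn, since all mass below such an interval stays near it.\<close>

definition split_point :: "ereal \<Rightarrow> ereal \<Rightarrow> real" where
  "split_point A B = (if atoms A B \<noteq> {} then barycenter p (atoms A B)
     else SOME c. A < ereal c \<and> ereal c < B \<and> (\<exists>t\<in>T. \<bar>c - t\<bar> < \<delta>))"

text \<open>Stronger than \<open>t\<close> not lying in the interval: its whole open
  \<open>\<delta>\<close>-neighbourhood must miss it. One inner point within \<open>\<delta>\<close>
  of \<open>t\<close> refutes \<open>outside\<close>, which is how the atom of an anchored interval
  is recognised.\<close>

definition outside :: "ereal \<Rightarrow> ereal \<Rightarrow> real \<Rightarrow> bool" where
  "outside A B t \<longleftrightarrow> ereal (t + \<delta>) \<le> A \<or> B \<le> ereal (t - \<delta>)"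

text \<open>Populated intervals still contain atoms. An interval is anchored at \<open>t\<close> once it has been cut
  off next to the isolated atom \<open>t\<close>.\<close>

definition populated :: "ereal \<Rightarrow> ereal \<Rightarrow> bool" where
  "populated A B \<longleftrightarrow> A < B \<and> atoms A B \<noteq> {} \<and>
     (\<forall>t\<in>T. (A \<le> ereal (t - \<delta>) \<and> ereal (t + \<delta>) \<le> B) \<or> outside A B t)"

definition anchored :: "real \<Rightarrow> ereal \<Rightarrow> ereal \<Rightarrow> bool" where
  "anchored t A B \<longleftrightarrow> t \<in> T \<and> atoms A B = {} \<and> (\<exists>c. A < ereal c \<and> ereal c < B \<and> \<bar>c - t\<bar> < \<delta>)
     \<and> (\<forall>t'\<in>T. t' \<noteq> t \<longrightarrow> outside A B t')"

lemma finite_atoms [simp]: "finite (atoms A B)"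
  using fin by (simp add: atoms_def)

lemma atoms_subset: "atoms A B \<subseteq> T"
  by (auto simp: atoms_def)

lemma sum_atoms_pos: "atoms A B \<noteq> {} \<Longrightarrow> 0 < sum p (atoms A B)"
  using pos atoms_subset[of A B] by (intro sum_pos finite_atoms) auto

lemma outside_imp_not_near:
  assumes "outside A B t" "A < ereal c" "ereal c < B"
  shows "\<delta> \<le> \<bar>c - t\<bar>"
proof -
  have "ereal (t + \<delta>) < ereal c \<or> ereal c < ereal (t - \<delta>)"
    using assms unfolding outside_def by (metis le_less_trans less_le_trans)
  then show ?thesis by auto
qed

lemma outside_mono: "outside A B t \<Longrightarrow> A \<le> A' \<Longrightarrow> B' \<le> B \<Longrightarrow> outside A' B' t"
  by (auto simp: outside_def intro: order_trans)

lemma anchored_unique: "anchored t A B \<Longrightarrow> anchored t' A B \<Longrightarrow> t = t'"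
  unfolding anchored_def using outside_imp_not_near by fastforce

lemma anchored_less: "anchored t A B \<Longrightarrow> A < B"
  unfolding anchored_def by (auto intro: less_trans)

lemma populated_bounds:
  assumes "populated A B" "t \<in> atoms A B"
  shows "A \<le> ereal (t - \<delta>)" "ereal (t + \<delta>) \<le> B"
proof -
  have "\<not> outside A B t"
    using outside_imp_not_near[of A B t t] \<delta> assms(2) by (auto simp: atoms_def)
  then show "A \<le> ereal (t - \<delta>)" "ereal (t + \<delta>) \<le> B"
    using assms by (auto simp: populated_def atoms_def)
qed

text \<open>The barycenter lies strictly between two atoms of the interval, so both halves receive
  atoms. By \<open>sep\<close> it keeps distance \<open>\<delta>\<close> from every atom, so no atom
  is lost at the cut and each retains its margin in the half that contains it.\<close>

lemma split_populated:
  assumes populated: "populated A B" and card: "1 < card (atoms A B)"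
  defines "c \<equiv> split_point A B"
  shows "populated A (ereal c)" "populated (ereal c) B" "atoms A B = atoms A (ereal c) \<union> atoms (ereal c) B"
proof -
  have ne: "atoms A B \<noteq> {}" using card by auto
  have c: "c = barycenter p (atoms A B)" using ne by (simp add: c_def split_point_def)
  obtain u v where u: "u \<in> atoms A B" "u < c" and v: "v \<in> atoms A B" "c < v"
    using barycenter_strict_bounds[of "atoms A B" p] pos card atoms_subset[of A B] unfolding c
    by (metis finite_atoms subsetD)
  have AB: "A < ereal u" "ereal v < B" using u v by (auto simp: atoms_def)
  have Ac: "A < ereal c" using AB(1) u(2) by (metis less_ereal.simps(1) less_trans)
  have cB: "ereal c < B" using AB(2) v(2) by (metis less_ereal.simps(1) less_trans)
  have sepc: "\<delta> \<le> \<bar>c - t\<bar>" if "t \<in> T" for t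
    unfolding c using that ne card by (intro sep atoms_subset) auto
  have "t < c \<or> c < t" if "t \<in> T" for t using sepc[OF that] \<delta> by linarith
  moreover have "ereal t < B" if "t < c" for t using that less_trans[OF _ cB, of "ereal t"] by simp
  moreover have "A < ereal t" if "c < t" for t using that less_trans[OF Ac, of "ereal t"] by simp
  ultimately show "atoms A B = atoms A (ereal c) \<union> atoms (ereal c) B"
    by (auto simp: atoms_def)
  have ne: "atoms A (ereal c) \<noteq> {}" "atoms (ereal c) B \<noteq> {}"
    using u v AB by (auto simp: atoms_def)
  have "(A \<le> ereal (t - \<delta>) \<and> ereal (t + \<delta>) \<le> ereal c) \<or> outside A (ereal c) t"
      "(ereal c \<le> ereal (t - \<delta>) \<and> ereal (t + \<delta>) \<le> B) \<or> outside (ereal c) B t" if t: "t \<in> T" for t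
  proof -
    have 1: "t + \<delta> \<le> c \<or> c \<le> t - \<delta>" using sepc[OF t] by linarith
    have 2: "A \<le> ereal (t - \<delta>) \<and> ereal (t + \<delta>) \<le> B \<or> outside A B t"
      using populated t by (auto simp: populated_def)
    have 3: "outside A (ereal c) t \<and> outside (ereal c) B t" if "outside A B t"
      using outside_mono[OF that] Ac cB by (simp add: less_imp_le)
    from 1 2 3 show "(A \<le> ereal (t - \<delta>) \<and> ereal (t + \<delta>) \<le> ereal c) \<or> outside A (ereal c) t"
      by (auto simp: outside_def)
    from 1 2 3 show "(ereal c \<le> ereal (t - \<delta>) \<and> ereal (t + \<delta>) \<le> B) \<or> outside (ereal c) B t"
      by (auto simp: outside_def)
  qed
  then show "populated A (ereal c)" "populated (ereal c) B"
    using Ac cB ne by (simp_all add: populated_def)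
qed

text \<open>The cut falls on the atom itself, so the open halves contain no atom, yet both reach up
  to \<open>t\<close>; the points \<open>t - \<delta> / 2\<close> and
  \<open>t + \<delta> / 2\<close> witness this.\<close>

lemma split_single:
  assumes populated: "populated A B" and t: "atoms A B = {t}"
  shows "split_point A B = t" "anchored t A (ereal t)" "anchored t (ereal t) B"
proof -
  have tT: "t \<in> T" "A < ereal t" "ereal t < B" using t by (auto simp: atoms_def)
  show "split_point A B = t" using t pos[OF tT(1)] by (simp add: split_point_def)
  have bd: "A \<le> ereal (t - \<delta>)" "ereal (t + \<delta>) \<le> B" using populated_bounds[OF populated, of t] t by auto
  have out: "outside A B t'" if "t' \<in> T" "t' \<noteq> t" for t'
  proof (rule ccontr)
    assume "\<not> outside A B t'"
    then have le: "A \<le> ereal (t' - \<delta>)" "ereal (t' + \<delta>) \<le> B" using populated that by (auto simp: populated_def)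
    have "A < ereal t'" by (rule le_less_trans[OF le(1)]) (use \<delta> in simp)
    moreover have "ereal t' < B" by (rule less_le_trans[OF _ le(2)]) (use \<delta> in simp)
    ultimately have "t' \<in> atoms A B" using that by (auto simp: atoms_def)
    with t that show False by auto
  qed
  have "A < ereal (t - \<delta> / 2)" by (rule le_less_trans[OF bd(1)]) (use \<delta> in simp)
  moreover have "ereal (t + \<delta> / 2) < B" by (rule less_le_trans[OF _ bd(2)]) (use \<delta> in simp)
  ultimately have ex: "\<exists>c. A < ereal c \<and> ereal c < ereal t \<and> \<bar>c - t\<bar> < \<delta>"
    "\<exists>c. ereal t < ereal c \<and> ereal c < B \<and> \<bar>c - t\<bar> < \<delta>"
    using \<delta> by (auto intro: exI[of _ "t - \<delta> / 2"]) (auto intro: exI[of _ "t + \<delta> / 2"])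
  have "atoms A (ereal t) \<subseteq> atoms A B - {t}" "atoms (ereal t) B \<subseteq> atoms A B - {t}"
    using less_trans[OF _ tT(3)] less_trans[OF tT(2)] by (auto simp: atoms_def simp del: less_ereal.simps(1))
  moreover have "outside A (ereal t) t' \<and> outside (ereal t) B t'" if "t' \<in> T" "t' \<noteq> t" for t'
    using outside_mono[OF out[OF that]] tT by (simp add: less_imp_le)
  ultimately show "anchored t A (ereal t)" "anchored t (ereal t) B"
    unfolding anchored_def t using tT(1) ex by auto
qed

text \<open>The chosen point is close to some atom, and all atoms except \<open>t\<close> are
  \<open>outside\<close>, so that atom is \<open>t\<close>. Points slightly left and right of the
  cut, still within \<open>\<delta>\<close> of \<open>t\<close>, anchor the two halves.\<close>

lemma split_anchored:
  assumes s: "anchored t A B"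
  defines "c \<equiv> split_point A B"
  shows "A < ereal c" "ereal c < B" "\<bar>c - t\<bar> < \<delta>" "anchored t A (ereal c)" "anchored t (ereal c) B"
proof -
  have tT: "t \<in> T" using s by (simp add: anchored_def)
  have "\<exists>c. A < ereal c \<and> ereal c < B \<and> (\<exists>t\<in>T. \<bar>c - t\<bar> < \<delta>)"
    using s by (auto simp: anchored_def)
  from someI_ex[OF this] have c: "A < ereal c" "ereal c < B" "\<exists>t\<in>T. \<bar>c - t\<bar> < \<delta>"
    using s by (auto simp: c_def split_point_def anchored_def)
  then show "A < ereal c" "ereal c < B" by auto
  show near: "\<bar>c - t\<bar> < \<delta>"
  proof -
    from c(3) obtain t' where t': "t' \<in> T" "\<bar>c - t'\<bar> < \<delta>" by auto
    then have "\<not> outside A B t'" using outside_imp_not_near[OF _ c(1,2)] by force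
    then have "t' = t" using s t' by (auto simp: anchored_def)
    with t' show ?thesis by simp
  qed
  have "max A (ereal (t - \<delta>)) < ereal c" using c near by auto
  then obtain d where d: "max A (ereal (t - \<delta>)) < ereal d" "ereal d < ereal c"
    using ereal_dense2 by blast
  have "ereal c < min B (ereal (t + \<delta>))" using c near by auto
  then obtain e where e: "ereal c < ereal e" "ereal e < min B (ereal (t + \<delta>))"
    using ereal_dense2 by blast
  have "atoms A (ereal c) \<subseteq> atoms A B" "atoms (ereal c) B \<subseteq> atoms A B"
    using less_trans[OF _ c(2)] less_trans[OF c(1)] by (auto simp: atoms_def simp del: less_ereal.simps(1))
  then have "atoms A (ereal c) = {}" "atoms (ereal c) B = {}"
    using s unfolding anchored_def by auto
  moreover have "outside A (ereal c) t'" "outside (ereal c) B t'" if "t' \<in> T" "t' \<noteq> t" for t'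
    using s that c outside_mono[of A B t'] by (auto simp: anchored_def less_imp_le)
  moreover have "\<bar>d - t\<bar> < \<delta>" "\<bar>e - t\<bar> < \<delta>" using d e near by auto
  ultimately show "anchored t A (ereal c)" "anchored t (ereal c) B"
    using tT d e unfolding anchored_def by auto
qed

lemma split_cases:
  assumes "populated A B \<or> (\<exists>t. anchored t A B)"
  obtains "populated A B" "1 < card (atoms A B)" | t where "populated A B" "atoms A B = {t}" | t where "anchored t A B"
proof -
  have "0 < card (atoms A B)" if "populated A B" using that by (simp add: populated_def card_gt_0_iff)
  then have "1 < card (atoms A B) \<or> is_singleton (atoms A B)" if "populated A B"
    using that by (auto simp: is_singleton_altdef)
  with assms show thesis using that by (auto simp: is_singleton_def)
qed

lemma split_interval:
  assumes "populated A B \<or> (\<exists>t. anchored t A B)"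
  shows "A < ereal (split_point A B)" "ereal (split_point A B) < B"
    "populated A (ereal (split_point A B)) \<or> (\<exists>t. anchored t A (ereal (split_point A B)))"
    "populated (ereal (split_point A B)) B \<or> (\<exists>t. anchored t (ereal (split_point A B)) B)"
proof -
  let ?c = "ereal (split_point A B)"
  have "A < ?c \<and> ?c < B \<and> (populated A ?c \<or> (\<exists>t. anchored t A ?c)) \<and> (populated ?c B \<or> (\<exists>t. anchored t ?c B))"
    using assms
  proof (cases rule: split_cases)
    case 1
    show ?thesis using split_populated(1,2)[OF 1] by (simp add: populated_def)
  next
    case (2 t)
    then have "A < ereal t" "ereal t < B" by (auto simp: atoms_def)
    then show ?thesis using split_single[OF 2] by auto
  next
    case (3 t)
    show ?thesis using split_anchored[OF 3] by auto
  qed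
  then show "A < ?c" "?c < B" "populated A ?c \<or> (\<exists>t. anchored t A ?c)" "populated ?c B \<or> (\<exists>t. anchored t ?c B)"
    by auto
qed

text \<open>The part of the mass of an interval that is attributed to the atom \<open>t\<close>. It is conserved under
  splitting because the ratio prescribed by the barycenters is the correct mass ratio.\<close>

definition share :: "ereal \<Rightarrow> ereal \<Rightarrow> real \<Rightarrow> real" where
  "share A B t = (if atoms A B \<noteq> {} then (if t \<in> atoms A B then p t / sum p (atoms A B) else 0)
     else if anchored t A B then 1 else 0)"

lemma share_anchored:
  assumes "anchored t A B"
  shows "share A B t' = (if t' = t then 1 else 0)"
proof -
  have "anchored t' A B \<longleftrightarrow> t' = t" using anchored_unique[OF assms] assms by blast
  moreover have "atoms A B = {}" using assms by (simp add: anchored_def)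
  ultimately show ?thesis by (simp add: share_def)
qed

text \<open>With several atoms, the law of the lever turns \<open>r\<close> into the fraction of
  mass on the left, and the shares of the halves average to the share of the whole. With a single
  atom, or in an anchored interval, both halves have the same share as the whole, and the identity
  holds for every value of \<open>r\<close>.\<close>

lemma share_split:
  assumes AB: "populated A B \<or> (\<exists>t. anchored t A B)"
  defines "c \<equiv> split_point A B"
  defines "r \<equiv> (split_point (ereal c) B - c) / (split_point (ereal c) B - split_point A (ereal c))"
  shows "share A B t = r * share A (ereal c) t + (1 - r) * share (ereal c) B t"
  using AB
proof (cases rule: split_cases)
  case 1
  let ?V = "atoms A (ereal c)" and ?W = "atoms (ereal c) B"
  note S = split_populated[OF 1, folded c_def]
  have ne: "?V \<noteq> {}" "?W \<noteq> {}" using S by (auto simp: populated_def)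
  have disj: "?V \<inter> ?W = {}" by (auto simp: atoms_def)
  have V: "split_point A (ereal c) = barycenter p ?V" and W: "split_point (ereal c) B = barycenter p ?W"
    using ne by (simp_all add: split_point_def)
  have "atoms A B \<noteq> {}" using 1 by auto
  then have c: "c = barycenter p (?V \<union> ?W)"
    unfolding S(3)[symmetric] by (simp add: c_def split_point_def)
  \<comment> \<open>Strict order of the three cuts rules out a vanishing denominator in
    \<open>r\<close>.\<close>
  have "ereal (split_point A (ereal c)) < ereal c" "ereal c < ereal (split_point (ereal c) B)"
    using split_interval[of A "ereal c"] split_interval[of "ereal c" B] S by auto
  then have "barycenter p ?V \<noteq> barycenter p ?W" using V W by simp
  then have r: "r = sum p ?V / sum p (?V \<union> ?W)"
    unfolding r_def V W using ne disj barycenter_union_ratio[of ?V ?W p, folded c]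
    by (simp add: sum_atoms_pos)
  have s: "sum p (?V \<union> ?W) = sum p ?V + sum p ?W"
    using disj by (simp add: sum.union_disjoint)
  have p: "0 < sum p ?V" "0 < sum p ?W" using ne by (auto simp: sum_atoms_pos)
  then have "1 - r = sum p ?W / sum p (?V \<union> ?W)"
    unfolding r s by (simp add: field_simps)
  note r' = this
  have "share A B t = (if t \<in> ?V \<union> ?W then p t / sum p (?V \<union> ?W) else 0)"
    unfolding share_def S(3) using ne by simp
  moreover have "share A (ereal c) t = (if t \<in> ?V then p t / sum p ?V else 0)"
    "share (ereal c) B t = (if t \<in> ?W then p t / sum p ?W else 0)"
    using ne by (simp_all add: share_def)
  ultimately show ?thesis
    using disj p unfolding r' unfolding r by auto
next
  case (2 t')
  note S = split_single[OF 2, folded c_def]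
  have "share A B t = (if t = t' then 1 else 0)"
    using 2 pos[of t'] atoms_subset[of A B] by (auto simp: share_def)
  then show ?thesis
    using share_anchored[OF S(2)] share_anchored[OF S(3)] unfolding S(1) by simp
next
  case (3 t')
  note S = split_anchored[OF 3, folded c_def]
  show ?thesis
    unfolding share_anchored[OF 3] share_anchored[OF S(4)] share_anchored[OF S(5)] by simp
qed

section \<open>The dyadic tree of cuts and the masses along it\<close>

fun tree_node :: "nat \<Rightarrow> nat \<Rightarrow> ereal" where
  "tree_node 0 k = (if k = 0 then a else b)"
| "tree_node (Suc j) k = (if even k then tree_node j (k div 2) else ereal (split_point (tree_node j (k div 2)) (tree_node j (Suc (k div 2)))))"

lemma tree_node_even: "tree_node (Suc j) (2 * m) = tree_node j m"
  by simp

lemma tree_node_odd: "tree_node (Suc j) (2 * m + 1) = ereal (split_point (tree_node j m) (tree_node j (Suc m)))"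
  by simp

lemma tree_node_ends: "tree_node j 0 = a" "tree_node j (2 ^ j) = b"
  by (induction j) auto

lemma root_inside:
  assumes "t \<in> T"
  shows "a < ereal t" "ereal t < b"
proof -
  show "a < ereal t" by (rule le_less_trans[OF conjunct1[OF margin[OF assms]]]) (use \<delta> in simp)
  show "ereal t < b" by (rule less_le_trans[OF _ conjunct2[OF margin[OF assms]]]) (use \<delta> in simp)
qed

lemma atoms_root: "atoms a b = T"
  by (auto simp: atoms_def root_inside)

lemma tree_node_interval: "k < 2 ^ j \<Longrightarrow> populated (tree_node j k) (tree_node j (Suc k)) \<or> (\<exists>t. anchored t (tree_node j k) (tree_node j (Suc k)))"
proof (induction j arbitrary: k)
  case 0
  note atoms_root
  moreover from ne obtain t where "t \<in> T" by auto
  then have "a < b" using root_inside less_trans by blast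
  ultimately have "populated a b" using ne margin by (auto simp: populated_def)
  then show ?case using 0 by simp
next
  case (Suc j)
  show ?case
  proof (cases "even k")
    case True
    then obtain m where k: "k = 2 * m" by (elim evenE)
    then have e: "tree_node (Suc j) k = tree_node j m" "tree_node (Suc j) (Suc k) = ereal (split_point (tree_node j m) (tree_node j (Suc m)))"
      and m: "m < 2 ^ j"
      using Suc.prems by auto
    show ?thesis
      unfolding e by (rule split_interval(3)[OF Suc.IH[OF m]])
  next
    case False
    then obtain m where k: "k = 2 * m + 1" by (elim oddE)
    then have e: "tree_node (Suc j) k = ereal (split_point (tree_node j m) (tree_node j (Suc m)))" "tree_node (Suc j) (Suc k) = tree_node j (Suc m)"
      and m: "m < 2 ^ j"
      using Suc.prems by auto
    show ?thesis
      unfolding e by (rule split_interval(4)[OF Suc.IH[OF m]])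
  qed
qed

lemma tree_node_less: "k < 2 ^ j \<Longrightarrow> tree_node j k < tree_node j (Suc k)"
  using tree_node_interval[of k j] by (auto simp: populated_def intro: anchored_less)

lemma tree_node_strict_mono: "k < k' \<Longrightarrow> k' \<le> 2 ^ j \<Longrightarrow> tree_node j k < tree_node j k'"
proof (induction k')
  case (Suc k')
  then have "tree_node j k' < tree_node j (Suc k')" by (intro tree_node_less) simp
  moreover have "k = k' \<or> tree_node j k < tree_node j k'"
    using Suc.IH Suc.prems by (cases "k = k'") auto
  ultimately show ?case by (metis less_trans)
qed simp

text \<open>While an interval holds several atoms, both halves receive some, so each half holds at
  least one fewer than its parent; after the cut through a single atom none remain. At level
  \<open>card T\<close> no interval can contain an atom any more.\<close>

lemma card_atoms_tree_node:
  "k < 2 ^ j \<Longrightarrow> atoms (tree_node j k) (tree_node j (Suc k)) \<noteq> {} \<Longrightarrow> card (atoms (tree_node j k) (tree_node j (Suc k))) + j \<le> card T"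
proof (induction j arbitrary: k)
  case 0
  then show ?case by (simp add: card_mono fin atoms_subset)
next
  case (Suc j)
  define m where "m = k div 2"
  have m: "m < 2 ^ j" using Suc.prems by (simp add: m_def)
  let ?A = "tree_node j m" and ?B = "tree_node j (Suc m)"
  let ?c = "ereal (split_point ?A ?B)"
  have "k = 2 * m \<or> k = 2 * m + 1 \<and> Suc k = 2 * Suc m" by (auto simp: m_def)
  then have c: "(tree_node (Suc j) k, tree_node (Suc j) (Suc k)) \<in> {(?A, ?c), (?c, ?B)}"
    using tree_node_odd[of j m] tree_node_even[of j m] tree_node_even[of j "Suc m"] by (auto simp del: tree_node.simps)
  from tree_node_interval[OF m] show ?case
  proof (cases rule: split_cases)
    case 1
    note S = split_populated[OF 1]
    have ne: "atoms ?A ?B \<noteq> {}" using 1(1) by (simp add: populated_def)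
    have "atoms ?A ?c \<inter> atoms ?c ?B = {}" by (auto simp: atoms_def)
    then have "card (atoms ?A ?B) = card (atoms ?A ?c) + card (atoms ?c ?B)"
      unfolding S(3) by (simp add: card_Un_disjoint)
    moreover have "0 < card (atoms ?A ?c)" "0 < card (atoms ?c ?B)"
      using S by (auto simp: populated_def card_gt_0_iff)
    ultimately have "card (atoms ?A ?c) + Suc j \<le> card T" "card (atoms ?c ?B) + Suc j \<le> card T"
      using Suc.IH[OF m ne] by auto
    then show ?thesis
      using c by (auto simp del: tree_node.simps)
  next
    case (2 t)
    then show ?thesis
      using split_single[OF 2] c Suc.prems(2) by (auto simp: anchored_def simp del: tree_node.simps)
  next
    case (3 t)
    then show ?thesis
      using split_anchored[OF 3] c Suc.prems(2) by (auto simp: anchored_def simp del: tree_node.simps)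
  qed
qed

definition tree_point :: "nat \<times> nat \<Rightarrow> real" where
  "tree_point q = real_of_ereal (tree_node (fst q) (snd q))"

lemma tree_point_odd: "tree_point (Suc j, 2 * m + 1) = split_point (tree_node j m) (tree_node j (Suc m))"
  unfolding tree_point_def by (simp only: fst_conv snd_conv tree_node_odd real_of_ereal.simps)

lemma node_tree_point: "k \<le> 2 ^ j \<Longrightarrow> node a b tree_point j k = tree_node j k"
proof (induction j arbitrary: k)
  case 0
  then show ?case by simp
next
  case (Suc j)
  show ?case
  proof (cases rule: nat_Suc_cases[where j = j and k = k])
    case 1
    then have "k = 2 ^ Suc j" using Suc.prems by simp
    then show ?thesis by (simp only: node_top[OF order_refl] tree_node_ends)
  next
    case (2 m)
    with Suc show ?thesis by (simp add: node_even del: node.simps)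
  next
    case (3 m)
    then have "k \<in> odd_idx (Suc j)" by (simp add: odd_idx_def)
    from node_odd[OF this] 3 show ?thesis by (simp only: tree_point_odd tree_node_odd)
  qed
qed

text \<open>The ratio of \<open>Fv_odd\<close> at the tree configuration, with ordinary division: by
  \<open>tree_point_less\<close> the denominator is positive, so it agrees with
  \<open>ratio0\<close>.\<close>

definition ratio :: "nat \<Rightarrow> nat \<Rightarrow> real" where
  "ratio j m = (tree_point (Suc (Suc j), 4 * m + 3) - tree_point (Suc j, 2 * m + 1)) / (tree_point (Suc (Suc j), 4 * m + 3) - tree_point (Suc (Suc j), 4 * m + 1))"

lemma tree_point_children:
  "tree_point (Suc (Suc j), 4 * m + 1) = split_point (tree_node j m) (ereal (split_point (tree_node j m) (tree_node j (Suc m))))"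
  "tree_point (Suc (Suc j), 4 * m + 3) = split_point (ereal (split_point (tree_node j m) (tree_node j (Suc m)))) (tree_node j (Suc m))"
proof -
  have "4 * m + 1 = 2 * (2 * m) + 1" "Suc (2 * m) = 2 * m + 1" by auto
  then show "tree_point (Suc (Suc j), 4 * m + 1) = split_point (tree_node j m) (ereal (split_point (tree_node j m) (tree_node j (Suc m))))"
    by (simp only: tree_point_odd tree_node_odd tree_node_even)
  have "4 * m + 3 = 2 * (2 * m + 1) + 1" "Suc (2 * m + 1) = 2 * Suc m" by auto
  then show "tree_point (Suc (Suc j), 4 * m + 3) = split_point (ereal (split_point (tree_node j m) (tree_node j (Suc m)))) (tree_node j (Suc m))"
    by (simp only: tree_point_odd tree_node_odd tree_node_even)
qed

lemma tree_point_less: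
  assumes "m < 2 ^ j"
  shows "tree_point (Suc (Suc j), 4 * m + 1) < tree_point (Suc j, 2 * m + 1)" "tree_point (Suc j, 2 * m + 1) < tree_point (Suc (Suc j), 4 * m + 3)"
proof -
  note I = split_interval[OF tree_node_interval[OF assms]]
  from split_interval(2)[OF I(3)] split_interval(1)[OF I(4)]
  show "tree_point (Suc (Suc j), 4 * m + 1) < tree_point (Suc j, 2 * m + 1)" "tree_point (Suc j, 2 * m + 1) < tree_point (Suc (Suc j), 4 * m + 3)"
    by (simp_all only: tree_point_children tree_point_odd less_ereal.simps)
qed

lemma ratio_bounds: "m < 2 ^ j \<Longrightarrow> 0 \<le> ratio j m \<and> ratio j m \<le> 1"
  using tree_point_less[of m j] by (simp add: ratio_def)

lemma Fv_tree_point_odd: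
  assumes "m < 2 ^ j"
  shows "Fv a b tree_point (Suc j) (2 * m + 1) = Fv a b tree_point j m + (Fv a b tree_point j (Suc m) - Fv a b tree_point j m) * ratio j m"
  using Fv_odd[OF assms, of a b tree_point] tree_point_less[OF assms] by (simp add: ratio0_def ratio_def)

lemma mass_split:
  assumes "m < 2 ^ j"
  shows "dsba_w a b (Suc j) tree_point (Suc (2 * m)) = dsba_w a b j tree_point (Suc m) * ratio j m"
    "dsba_w a b (Suc j) tree_point (Suc (2 * m + 1)) = dsba_w a b j tree_point (Suc m) * (1 - ratio j m)"
proof -
  have "Suc (2 * m + 1) = 2 * Suc m" by simp
  then show "dsba_w a b (Suc j) tree_point (Suc (2 * m)) = dsba_w a b j tree_point (Suc m) * ratio j m"
    "dsba_w a b (Suc j) tree_point (Suc (2 * m + 1)) = dsba_w a b j tree_point (Suc m) * (1 - ratio j m)"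
    using Fv_tree_point_odd[OF assms] Fv_even[of a b tree_point j m] Fv_even[of a b tree_point j "Suc m"]
    unfolding dsba_w_def by (simp_all add: algebra_simps del: Fv.simps)
qed

lemma mass_nonneg: "k < 2 ^ j \<Longrightarrow> 0 \<le> dsba_w a b j tree_point (Suc k)"
proof (induction j arbitrary: k)
  case 0
  then show ?case by (simp add: dsba_w_def)
next
  case (Suc j)
  define m where "m = k div 2"
  have m: "m < 2 ^ j" using Suc.prems by (simp add: m_def)
  have "k = 2 * m \<or> k = 2 * m + 1" by (auto simp: m_def)
  then show ?case
    using mass_split[OF m] Suc.IH[OF m] ratio_bounds[OF m] by auto
qed

lemma sum_lessThan_double: "(\<Sum>l<2 * N. g l) = (\<Sum>m<N. g (2 * m) + g (2 * m + 1))"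
  for g :: "nat \<Rightarrow> real"
  by (induction N) (auto simp: algebra_simps)

text \<open>The masses of two siblings arise from their parent by the same ratio that recombines
  their shares in \<open>share_split\<close>, so the sum is the same at all levels. At the root
  there is a single interval of mass \<open>1\<close> containing all atoms, and its share is
  \<open>p t\<close>.\<close>

lemma sum_mass_share:
  assumes "t \<in> T"
  shows "(\<Sum>k<2 ^ j. dsba_w a b j tree_point (Suc k) * share (tree_node j k) (tree_node j (Suc k)) t) = p t"
proof (induction j)
  case 0
  show ?case using ne assms sum1 by (simp add: dsba_w_def share_def atoms_root)
next
  case (Suc j)
  let ?g = "\<lambda>k. dsba_w a b (Suc j) tree_point (Suc k) * share (tree_node (Suc j) k) (tree_node (Suc j) (Suc k)) t"
  have "?g (2 * m) + ?g (2 * m + 1) = dsba_w a b j tree_point (Suc m) * share (tree_node j m) (tree_node j (Suc m)) t"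
    if m: "m < 2 ^ j" for m
  proof -
    have "tree_node (Suc j) (Suc (2 * m)) = ereal (split_point (tree_node j m) (tree_node j (Suc m)))" "tree_node (Suc j) (Suc (2 * m + 1)) = tree_node j (Suc m)"
      by simp_all
    then have "share (tree_node j m) (tree_node j (Suc m)) t
      = ratio j m * share (tree_node (Suc j) (2 * m)) (tree_node (Suc j) (Suc (2 * m))) t
        + (1 - ratio j m) * share (tree_node (Suc j) (2 * m + 1)) (tree_node (Suc j) (Suc (2 * m + 1))) t"
      using share_split[OF tree_node_interval[OF m]] by (simp only: tree_node_even tree_node_odd ratio_def tree_point_children tree_point_odd)
    then show ?thesis
      by (simp only: mass_split[OF m] distrib_left mult.assoc)
  qed
  then have "(\<Sum>k<2 ^ Suc j. ?g k) = (\<Sum>m<2 ^ j. dsba_w a b j tree_point (Suc m) * share (tree_node j m) (tree_node j (Suc m)) t)"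
    unfolding power_Suc sum_lessThan_double by (intro sum.cong refl) auto
  then show ?case using Suc.IH by (simp del: tree_node.simps)
qed

text \<open>At depth \<open>card T\<close> every interval is anchored, at an atom recorded by
  \<open>col\<close>. Its cut is the support point \<open>dsba_theta\<close>, hence close to that
  atom, and its share is an indicator. Summing weights over the intervals with the same
  \<open>col\<close> thus recovers \<open>p\<close> exactly, although single weights are not
  known.\<close>

lemma exists_nodes:
  defines "n \<equiv> card T"
  obtains x0 col where
    "\<And>j k. k < 2 ^ j \<Longrightarrow> node a b x0 j k < node a b x0 j (Suc k)"
    "\<And>q. q \<in> Lev (Suc n) \<Longrightarrow> a < ereal (x0 q) \<and> ereal (x0 q) < b"
    "\<And>l. l \<in> {1..2 ^ n} \<Longrightarrow> 0 \<le> dsba_w a b n x0 l"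
    "\<And>l. l \<in> {1..2 ^ n} \<Longrightarrow> col l \<in> T"
    "\<And>l. l \<in> {1..2 ^ n} \<Longrightarrow> \<bar>dsba_theta a b n x0 l - col l\<bar> < \<delta>"
    "\<And>h. (\<Sum>l\<in>{1..2 ^ n}. dsba_w a b n x0 l * h (col l)) = (\<Sum>t\<in>T. p t * h t)"
proof -
  have sm: "\<exists>t. anchored t (tree_node n k) (tree_node n (Suc k))" if "k < 2 ^ n" for k
  proof -
    have "\<not> populated (tree_node n k) (tree_node n (Suc k))"
    proof
      assume "populated (tree_node n k) (tree_node n (Suc k))"
      then have "0 < card (atoms (tree_node n k) (tree_node n (Suc k)))" "atoms (tree_node n k) (tree_node n (Suc k)) \<noteq> {}"
        by (auto simp: populated_def card_gt_0_iff)
      with card_atoms_tree_node[OF that] show False by (simp add: n_def)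
    qed
    with tree_node_interval[OF that] show ?thesis by auto
  qed
  then have "\<exists>t. \<forall>k\<in>{..<2 ^ n}. anchored (t k) (tree_node n k) (tree_node n (Suc k))"
    by (intro bchoice) auto
  then obtain t where t: "\<And>k. k < 2 ^ n \<Longrightarrow> anchored (t k) (tree_node n k) (tree_node n (Suc k))" by auto
  \<comment> \<open>Intervals of the tree are numbered from \<open>0\<close>, weights and support
    points from \<open>1\<close>.\<close>
  define col where "col l = t (l - 1)" for l
  have idx: "l - 1 < 2 ^ n \<and> Suc (l - 1) = l" if "l \<in> {1..2 ^ n}" for l :: nat
    using that by auto
  show thesis
  proof (rule that[of tree_point col])
    show "node a b tree_point j k < node a b tree_point j (Suc k)" if "k < 2 ^ j" for j k
      using that tree_node_less[OF that] by (simp add: node_tree_point)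
    show "a < ereal (tree_point q) \<and> ereal (tree_point q) < b" if q_in: "q \<in> Lev (Suc n)" for q
    proof -
      obtain i k where q: "q = (i, k)" "1 \<le> i" "k \<in> odd_idx i"
        using q_in by (auto simp: Lev_def)
      then obtain j where j: "i = Suc j" by (cases i) auto
      have k: "0 < k" "k < 2 ^ Suc j" using odd_idx_pos[OF q(3)] q(3) j by (auto simp: odd_idx_def)
      have "ereal (tree_point q) = tree_node (Suc j) k"
        using node_odd[of k j a b tree_point] node_tree_point[of k "Suc j"] q j k by simp
      then show ?thesis
        using tree_node_strict_mono[of 0 k "Suc j"] tree_node_strict_mono[of k "2 ^ Suc j" "Suc j"] k
        by (simp only: tree_node_ends)
    qed
    fix l :: nat assume l: "l \<in> {1..2 ^ n}"
    show "0 \<le> dsba_w a b n tree_point l"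
      using mass_nonneg[of "l - 1" n] idx[OF l] by simp
    show "col l \<in> T" using t[of "l - 1"] idx[OF l] by (auto simp: col_def anchored_def)
    have "dsba_theta a b n tree_point l = split_point (tree_node n (l - 1)) (tree_node n (Suc (l - 1)))"
    proof -
      have "2 * l - 1 = 2 * (l - 1) + 1" using l by auto
      then show ?thesis using dsba_theta_eq(1)[OF l, of a b tree_point] tree_point_odd[of n "l - 1"] by (simp only:)
    qed
    then show "\<bar>dsba_theta a b n tree_point l - col l\<bar> < \<delta>"
      using split_anchored(3)[OF t[of "l - 1"]] idx[OF l] by (simp add: col_def)
  next
    fix h :: "real \<Rightarrow> real"
    let ?w = "\<lambda>k. dsba_w a b n tree_point (Suc k)" and ?s = "\<lambda>k. share (tree_node n k) (tree_node n (Suc k))"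
    have "(\<Sum>l\<in>{1..2 ^ n}. dsba_w a b n tree_point l * h (col l)) = (\<Sum>k<2 ^ n. ?w k * h (t k))"
      by (rule sum.reindex_bij_witness[of _ Suc "\<lambda>l. l - 1"]) (auto simp: col_def)
    \<comment> \<open>The share of an anchored interval is \<open>1\<close> at its atom and
      \<open>0\<close> at all others, so it can be inserted together with a sum over
      \<open>T\<close>; exchanging the sums then brings in \<open>sum_mass_share\<close>.\<close>
    also have "\<dots> = (\<Sum>k<2 ^ n. \<Sum>u\<in>T. ?w k * ?s k u * h u)"
    proof (rule sum.cong[OF refl])
      fix k assume k: "k \<in> {..<2 ^ n :: nat}"
      then have s: "anchored (t k) (tree_node n k) (tree_node n (Suc k))" using t by auto
      have "(\<Sum>u\<in>T. ?w k * ?s k u * h u) = (\<Sum>u\<in>T. if u = t k then ?w k * h u else 0)"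
        by (intro sum.cong refl) (auto simp: share_anchored[OF s])
      also have "\<dots> = ?w k * h (t k)"
        using s fin by (simp add: anchored_def)
      finally show "?w k * h (t k) = (\<Sum>u\<in>T. ?w k * ?s k u * h u)" by simp
    qed
    also have "\<dots> = (\<Sum>u\<in>T. (\<Sum>k<2 ^ n. ?w k * ?s k u) * h u)"
      by (subst sum.swap) (simp add: sum_distrib_right)
    also have "\<dots> = (\<Sum>u\<in>T. p u * h u)"
      by (intro sum.cong refl) (simp add: sum_mass_share)
    finally show "(\<Sum>l\<in>{1..2 ^ n}. dsba_w a b n tree_point l * h (col l)) = (\<Sum>u\<in>T. p u * h u)" .
  qed
qed

end

section \<open>Discretization of the target\<close>

text \<open>Shifting the points by distinct powers of a parameter \<open>s\<close> turns each forbidden identity into a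
  nonzero polynomial equation in \<open>s\<close>.\<close>

lemma exists_generic_points:
  fixes V :: "'i \<Rightarrow> real set" and p :: "'i \<Rightarrow> real"
  assumes I: "finite I" and V: "\<And>i. i \<in> I \<Longrightarrow> open (V i)" "\<And>i. i \<in> I \<Longrightarrow> V i \<noteq> {}"
    and p: "\<And>i. i \<in> I \<Longrightarrow> 0 < p i"
  obtains \<tau> where "\<And>i. i \<in> I \<Longrightarrow> \<tau> i \<in> V i"
    "\<And>U j. U \<subseteq> I \<Longrightarrow> U \<noteq> {} \<Longrightarrow> j \<in> I \<Longrightarrow> U \<noteq> {j} \<Longrightarrow> (\<Sum>u\<in>U. p u * (\<tau> u - \<tau> j)) \<noteq> 0"
proof -
  obtain e :: "'i \<Rightarrow> nat" where e: "inj_on e I"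
    using finite_imp_inj_to_nat_seg[OF I] by auto
  have "\<exists>v. \<forall>i\<in>I. v i \<in> V i" using V(2) by (intro bchoice) auto
  then obtain v where v: "\<And>i. i \<in> I \<Longrightarrow> v i \<in> V i" by auto
  have "\<exists>r. \<forall>i\<in>I. 0 < r i \<and> ball (v i) (r i) \<subseteq> V i"
    using V(1) v by (intro bchoice) (auto simp: open_contains_ball)
  then obtain r where r: "\<And>i. i \<in> I \<Longrightarrow> 0 < r i" "\<And>i. i \<in> I \<Longrightarrow> ball (v i) (r i) \<subseteq> V i" by auto
  \<comment> \<open>Evaluated at \<open>s\<close>, this is the sum that must not vanish, at points
    shifted by \<open>s ^ Suc (e i)\<close>. The \<open>Suc\<close> keeps the shifts out of the
    constant coefficient, where the differences of the \<open>v\<close> sit.\<close>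
  define q where "q U j = (\<Sum>u\<in>U. smult (p u) ([:v u - v j:] + monom 1 (Suc (e u)) - monom 1 (Suc (e j))))" for U j
  have q_eval: "poly (q U j) s = (\<Sum>u\<in>U. p u * ((v u + s ^ Suc (e u)) - (v j + s ^ Suc (e j))))" for U j s
    unfolding q_def by (simp add: poly_sum poly_monom algebra_simps)
  have q_nz: "q U j \<noteq> 0" if U: "U \<subseteq> I" "U \<noteq> {}" "j \<in> I" "U \<noteq> {j}" for U j
  proof -
    \<comment> \<open>An index \<open>k\<close> other than \<open>j\<close> exists because
      \<open>U\<close> is neither empty nor \<open>{j}\<close>. No other monomial has its degree, so
      the coefficient there is just \<open>p k\<close>.\<close>
    obtain k where k: "k \<in> U" "k \<noteq> j" using U by auto
    have "coeff (q U j) (Suc (e k)) = (\<Sum>u\<in>U. if u = k then p u else 0)"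
      unfolding q_def coeff_sum
    proof (rule sum.cong[OF refl])
      fix u assume "u \<in> U"
      then have "e u = e k \<longleftrightarrow> u = k" "e j \<noteq> e k"
        using e k U by (auto dest: inj_onD)
      then show "coeff (smult (p u) ([:v u - v j:] + monom 1 (Suc (e u)) - monom 1 (Suc (e j)))) (Suc (e k))
          = (if u = k then p u else 0)"
        by simp
    qed
    also have "\<dots> = p k" using k U finite_subset[OF U(1) I] by simp
    also have "\<dots> \<noteq> 0" using p[of k] k U by auto
    finally show ?thesis by auto
  qed
  define B where "B = {(U, j). U \<subseteq> I \<and> U \<noteq> {} \<and> j \<in> I \<and> U \<noteq> {j}}"
  have "finite B"
    by (rule finite_subset[of _ "Pow I \<times> I"]) (use I in \<open>auto simp: B_def\<close>)
  then have fin: "finite (\<Union>(U, j)\<in>B. {s. poly (q U j) s = 0})"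
    using q_nz by (auto simp: B_def intro!: poly_roots_finite)
  \<comment> \<open>The bound \<open>1\<close> ensures \<open>s ^ Suc (e i) \<le> s\<close>, and the
    bound by the radii then keeps every shifted point in its ball.\<close>
  define c where "c = Min (insert 1 (r ` I))"
  have c: "0 < c" "c \<le> 1" "\<And>i. i \<in> I \<Longrightarrow> c \<le> r i"
    using I r(1) by (auto simp: c_def)
  have "infinite {0<..<c}" using c(1) by (rule infinite_Ioo)
  then have "infinite ({0<..<c} - (\<Union>(U, j)\<in>B. {s. poly (q U j) s = 0}))"
    using fin by (rule Diff_infinite_finite[rotated])
  then obtain s where "s \<in> {0<..<c} - (\<Union>(U, j)\<in>B. {s. poly (q U j) s = 0})"
    using infinite_imp_nonempty by blast
  then have s: "0 < s" "s < c" "\<And>U j. (U, j) \<in> B \<Longrightarrow> poly (q U j) s \<noteq> 0" by auto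
  show thesis
  proof (rule that[of "\<lambda>i. v i + s ^ Suc (e i)"])
    fix i assume i: "i \<in> I"
    have "s ^ Suc (e i) \<le> s ^ 1"
      using s c by (intro power_decreasing) auto
    moreover have "0 < s ^ Suc (e i)" using s by simp
    ultimately have "v i + s ^ Suc (e i) \<in> ball (v i) (r i)"
      using s c(3)[OF i] by (simp add: dist_real_def del: power_Suc)
    then show "v i + s ^ Suc (e i) \<in> V i" using r(2)[OF i] by blast
  next
    fix U j assume "U \<subseteq> I" "U \<noteq> {}" "j \<in> I" "U \<noteq> {j}"
    then show "(\<Sum>u\<in>U. p u * (v u + s ^ Suc (e u) - (v j + s ^ Suc (e j)))) \<noteq> 0"
      using s(3)[of U j] by (simp add: q_eval B_def)
  qed
qed

text \<open>The cells are the level sets of the rounded functions \<open>f k\<close>, so neither compactness nor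
  tightness is needed.\<close>

lemma exists_finite_quantization:
  fixes f :: "nat \<Rightarrow> 'a :: topological_space \<Rightarrow> real"
  assumes Q: "sets Q = sets borel" "prob_space Q" and S: "S \<in> sets borel" "emeasure Q (UNIV - S) = 0"
    and f: "\<And>k. k < K \<Longrightarrow> f k \<in> borel_measurable borel" "\<And>k. k < K \<Longrightarrow> bounded (f k ` S)"
    and \<epsilon>: "0 < \<epsilon>"
  obtains I :: "(nat \<Rightarrow> int) set" and z p where "finite I" "\<And>i. i \<in> I \<Longrightarrow> z i \<in> S" "\<And>i. i \<in> I \<Longrightarrow> 0 < p i" "sum p I = 1"
    "\<And>k. k < K \<Longrightarrow> \<bar>(\<Sum>i\<in>I. p i * f k (z i)) - (\<integral>x. f k x \<partial>Q)\<bar> < \<epsilon>"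
proof -
  interpret prob_space Q by (rule Q)
  note [measurable_cong] = Q(1)
  note [measurable] = S(1)
  have sp: "space Q = UNIV" using sets_eq_imp_space_eq[OF Q(1)] by simp
  \<comment> \<open>Integration preserves only the non-strict bound \<open>\<le> \<eta>\<close>;
    half of \<open>\<epsilon>\<close> leaves the required strictness.\<close>
  define \<eta> where "\<eta> = \<epsilon> / 2"
  have \<eta>: "0 < \<eta>" using \<epsilon> by (simp add: \<eta>_def)
  have "\<exists>b. \<forall>k\<in>{..<K}. \<forall>x\<in>S. \<bar>f k x\<bar> \<le> b k"
    using f(2) by (intro bchoice) (auto simp: bounded_iff)
  then obtain b where b: "\<And>k x. k < K \<Longrightarrow> x \<in> S \<Longrightarrow> \<bar>f k x\<bar> \<le> b k" by auto
  \<comment> \<open>Rounding on a grid of mesh \<open>\<eta>\<close>: points with equal codes have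
    values less than \<open>\<eta>\<close> apart under every \<open>f k\<close>. Restriction to
    \<open>{..<K}\<close> makes equality of codes concern these \<open>k\<close> only.\<close>
  define code where "code x = (\<lambda>k\<in>{..<K}. \<lfloor>f k x / \<eta>\<rfloor>)" for x
  define A where "A c = {x \<in> S. code x = c}" for c
  have fin: "finite (code ` S)"
  proof (rule finite_subset)
    show "code ` S \<subseteq> (\<Pi>\<^sub>E k\<in>{..<K}. {\<lfloor>- b k / \<eta>\<rfloor>..\<lfloor>b k / \<eta>\<rfloor>})"
    proof
      fix c assume "c \<in> code ` S"
      then obtain x where x: "x \<in> S" "c = code x" by auto
      have "\<lfloor>- b k / \<eta>\<rfloor> \<le> \<lfloor>f k x / \<eta>\<rfloor> \<and> \<lfloor>f k x / \<eta>\<rfloor> \<le> \<lfloor>b k / \<eta>\<rfloor>" if "k < K" for k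
        using b[OF that x(1)] \<eta> by (intro conjI floor_mono divide_right_mono) auto
      then show "c \<in> (\<Pi>\<^sub>E k\<in>{..<K}. {\<lfloor>- b k / \<eta>\<rfloor>..\<lfloor>b k / \<eta>\<rfloor>})"
        unfolding x(2) code_def by (auto simp: PiE_iff)
    qed
  qed (auto intro!: finite_PiE)
  have A_sets: "A c \<in> sets Q" if c: "c \<in> code ` S" for c
  proof -
    have "A c = S \<inter> (\<Inter>k\<in>{..<K}. {x \<in> space Q. real_of_int (c k) \<le> f k x / \<eta> \<and> f k x / \<eta> < real_of_int (c k) + 1}) \<inter> space Q"
      using c unfolding A_def code_def
      by (auto simp: sp fun_eq_iff restrict_def floor_eq_iff)
    also have "\<dots> \<in> sets Q"
    proof -
      have "{x \<in> space Q. real_of_int (c k) \<le> f k x / \<eta> \<and> f k x / \<eta> < real_of_int (c k) + 1} \<in> sets Q" if "k < K" for k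
      proof -
        note [measurable] = f(1)[OF that]
        show ?thesis by measurable
      qed
      then show ?thesis
        using S(1) Q(1) by (cases "K = 0") (auto intro!: sets.Int sets.finite_INT simp: sp)
    qed
    finally show ?thesis .
  qed
  define z where "z c = (SOME x. x \<in> A c)" for c
  have zA: "z c \<in> A c" if "c \<in> code ` S" for c
    unfolding z_def by (rule someI_ex) (use that in \<open>auto simp: A_def\<close>)
  \<comment> \<open>Cells of mass zero are dropped, as the point masses have to be strictly
    positive.\<close>
  define I where "I = {c \<in> code ` S. 0 < measure Q (A c)}"
  have nonI: "measure Q (A c) = 0" if "c \<in> code ` S - I" for c
    using that measure_nonneg[of Q "A c"] by (auto simp: I_def)
  have AE_S: "AE x in Q. x \<in> S"
    using S Q(1) by (intro AE_I[of _ _ "UNIV - S"]) (auto simp: sp)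
  have sum1: "(\<Sum>c\<in>code ` S. measure Q (A c)) = 1"
  proof -
    have "(\<Sum>c\<in>code ` S. measure Q (A c)) = measure Q (\<Union>c\<in>code ` S. A c)"
      using fin A_sets by (intro finite_measure_finite_Union[symmetric]) (auto simp: disjoint_family_on_def A_def)
    also have "(\<Union>c\<in>code ` S. A c) = S" by (auto simp: A_def)
    also have "measure Q S = 1"
      using AE_S S(1) Q(1) by (subst prob_eq_1) auto
    finally show ?thesis .
  qed
  show thesis
  proof (rule that[of I z "\<lambda>c. measure Q (A c)"])
    show "finite I" using fin by (simp add: I_def)
    show "z i \<in> S" if "i \<in> I" for i using zA[of i] that by (auto simp: I_def A_def)
    show "0 < measure Q (A i)" if "i \<in> I" for i using that by (simp add: I_def)
    show "(\<Sum>c\<in>I. measure Q (A c)) = 1"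
      unfolding sum1[symmetric] by (rule sum.mono_neutral_left) (use fin nonI in \<open>auto simp: I_def\<close>)
  next
    fix k assume k: "k < K"
    note [measurable] = f(1)[OF k]
    define g where "g x = (\<Sum>c\<in>code ` S. f k (z c) * indicator (A c) x)" for x
    have ind: "integrable Q (indicator (A c) :: _ \<Rightarrow> real)" if "c \<in> code ` S" for c
      using A_sets[OF that] by (intro integrable_real_indicator) (auto simp: less_top[symmetric])
    have g_int: "integrable Q g"
      unfolding g_def by (intro Bochner_Integration.integrable_sum integrable_mult_right ind)
    have f_int: "integrable Q (f k)"
      using AE_S b[OF k] by (intro integrable_const_bound[of _ "b k"]) auto
    have "(\<Sum>c\<in>I. measure Q (A c) * f k (z c)) = (\<Sum>c\<in>code ` S. f k (z c) * measure Q (A c))"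
      unfolding mult.commute[of _ "f k _"] by (rule sum.mono_neutral_left) (use fin nonI in \<open>auto simp: I_def\<close>)
    also have "\<dots> = (\<integral>x. g x \<partial>Q)"
      unfolding g_def
      by (subst Bochner_Integration.integral_sum) (simp_all add: sp integrable_mult_right ind)
    finally have eq: "(\<Sum>c\<in>I. measure Q (A c) * f k (z c)) = (\<integral>x. g x \<partial>Q)" .
    have "\<bar>g x - f k x\<bar> \<le> \<eta>" if x: "x \<in> S" for x
    proof -
      have "g x = (\<Sum>c\<in>code ` S. if c = code x then f k (z c) else 0)"
        unfolding g_def using x by (intro sum.cong refl) (auto simp: A_def)
      also have "\<dots> = f k (z (code x))" using x fin by simp
      finally have gx: "g x = f k (z (code x))" .
      have "code (z (code x)) = code x" using zA[of "code x"] x by (auto simp: A_def)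
      then have "\<lfloor>f k (z (code x)) / \<eta>\<rfloor> = \<lfloor>f k x / \<eta>\<rfloor>"
        using k by (auto simp: code_def fun_eq_iff restrict_def split: if_splits dest: spec[of _ k])
      then have "\<bar>f k (z (code x)) / \<eta> - f k x / \<eta>\<bar> < 1"
        by linarith
      then have "\<bar>(f k (z (code x)) - f k x) / \<eta>\<bar> < 1"
        by (simp add: diff_divide_distrib)
      then show ?thesis unfolding gx using \<eta> by (simp add: abs_divide divide_less_eq)
    qed
    then have "AE x in Q. norm (g x - f k x) \<le> \<eta>" using AE_S by auto
    then have "(\<integral>x. norm (g x - f k x) \<partial>Q) \<le> (\<integral>x. \<eta> \<partial>Q)"
      using g_int f_int by (intro integral_mono_AE) auto
    then have "(\<integral>x. norm (g x - f k x) \<partial>Q) \<le> \<eta>" by (simp add: prob_space)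
    then have "norm (\<integral>x. g x - f k x \<partial>Q) \<le> \<eta>"
      by (rule order_trans[OF integral_norm_bound])
    then show "\<bar>(\<Sum>c\<in>I. measure Q (A c) * f k (z c)) - (\<integral>x. f k x \<partial>Q)\<bar> < \<epsilon>"
      unfolding eq using g_int f_int \<epsilon> by (simp add: \<eta>_def)
  qed
qed

section \<open>Separation constants, displacement into the interior, and assembly of the
  configuration\<close>

lemma eventually_less_at_right_0: "0 < (c::real) \<Longrightarrow> eventually (\<lambda>d. d < c) (at_right 0)"
  by (rule order_tendstoD[OF tendsto_ident_at])

text \<open>Each requirement is met by all sufficiently small positive numbers, and there are
  finitely many of them, so they hold together along \<open>at_right 0\<close>.\<close>

lemma exists_separation:
  fixes a b :: ereal and T :: "real set" and p y :: "real \<Rightarrow> real" and f :: "nat \<Rightarrow> real \<times> real \<Rightarrow> real"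
  assumes T: "finite T" and inside: "\<And>t. t \<in> T \<Longrightarrow> a < ereal t \<and> ereal t < b"
    and generic: "\<And>U t. U \<subseteq> T \<Longrightarrow> U \<noteq> {} \<Longrightarrow> t \<in> T \<Longrightarrow> U \<noteq> {t} \<Longrightarrow> barycenter p U \<noteq> t"
    and y: "\<And>t. t \<in> T \<Longrightarrow> 0 \<le> y t"
    and f: "\<And>k. k < K \<Longrightarrow> continuous_on (Theta a b \<times> {0..}) (f k)" and \<epsilon>: "0 < \<epsilon>"
  obtains \<delta> where "0 < \<delta>" "\<And>t. t \<in> T \<Longrightarrow> a \<le> ereal (t - \<delta>) \<and> ereal (t + \<delta>) \<le> b"
    "\<And>U t. U \<subseteq> T \<Longrightarrow> U \<noteq> {} \<Longrightarrow> t \<in> T \<Longrightarrow> U \<noteq> {t} \<Longrightarrow> \<delta> \<le> \<bar>barycenter p U - t\<bar>"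
    "\<And>t k s. t \<in> T \<Longrightarrow> k < K \<Longrightarrow> \<bar>s - t\<bar> < \<delta> \<Longrightarrow> \<bar>f k (s, y t) - f k (t, y t)\<bar> < \<epsilon>"
proof -
  define B where "B = {(U, t). U \<subseteq> T \<and> U \<noteq> {} \<and> t \<in> T \<and> U \<noteq> {t}}"
  have "finite B"
    by (rule finite_subset[of _ "Pow T \<times> T"]) (use T in \<open>auto simp: B_def\<close>)
  then have "eventually (\<lambda>d. \<forall>(U, t)\<in>B. d < \<bar>barycenter p U - t\<bar>) (at_right 0)"
  proof (rule eventually_ball_finite)
    show "\<forall>q\<in>B. eventually (\<lambda>d. case q of (U, t) \<Rightarrow> d < \<bar>barycenter p U - t\<bar>) (at_right 0)"
    proof
      fix q assume "q \<in> B"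
      moreover obtain U t where "q = (U, t)" by (cases q)
      ultimately have "barycenter p U \<noteq> t" "q = (U, t)" using generic[of U t] by (auto simp: B_def)
      then show "eventually (\<lambda>d. case q of (U, t) \<Rightarrow> d < \<bar>barycenter p U - t\<bar>) (at_right 0)"
        using eventually_less_at_right_0[of "\<bar>barycenter p U - t\<bar>"] by simp
    qed
  qed
  moreover have "eventually (\<lambda>d. \<forall>t\<in>T. a < ereal (t - d) \<and> ereal (t + d) < b) (at_right 0)"
  proof (intro eventually_ball_finite T ballI eventually_conj)
    fix t assume t: "t \<in> T"
    have "((\<lambda>d. ereal (t - d)) \<longlongrightarrow> ereal (t - 0)) (at_right 0)" "((\<lambda>d. ereal (t + d)) \<longlongrightarrow> ereal (t + 0)) (at_right 0)"
      by (intro tendsto_intros)+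
    then show "eventually (\<lambda>d. a < ereal (t - d)) (at_right 0)" "eventually (\<lambda>d. ereal (t + d) < b) (at_right 0)"
      using inside[OF t] by (auto intro: order_tendstoD)
  qed
  moreover have "eventually (\<lambda>d. \<forall>t\<in>T. \<forall>k\<in>{..<K}. \<forall>s. \<bar>s - t\<bar> < d \<longrightarrow> s \<in> Theta a b \<longrightarrow> \<bar>f k (s, y t) - f k (t, y t)\<bar> < \<epsilon>) (at_right 0)"
  proof (intro eventually_ball_finite T finite_lessThan ballI)
    fix t k assume t: "t \<in> T" and k: "k \<in> {..<K}"
    have "(t, y t) \<in> Theta a b \<times> {0..}"
      using inside[OF t] y[OF t] by (auto simp: Theta_def)
    from f[of k, unfolded continuous_on_iff, rule_format, OF _ this \<epsilon>] k obtain d where d: "0 < d"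
      "\<And>z. z \<in> Theta a b \<times> {0..} \<Longrightarrow> dist z (t, y t) < d \<Longrightarrow> dist (f k z) (f k (t, y t)) < \<epsilon>"
      unfolding lessThan_iff by blast
    from eventually_less_at_right_0[OF d(1)]
    show "eventually (\<lambda>d. \<forall>s. \<bar>s - t\<bar> < d \<longrightarrow> s \<in> Theta a b \<longrightarrow> \<bar>f k (s, y t) - f k (t, y t)\<bar> < \<epsilon>) (at_right 0)"
    proof eventually_elim
      case (elim d')
      show ?case
      proof (intro allI impI)
        fix s assume "\<bar>s - t\<bar> < d'" "s \<in> Theta a b"
        then show "\<bar>f k (s, y t) - f k (t, y t)\<bar> < \<epsilon>"
          using elim y[OF t] d(2)[of "(s, y t)"] by (simp add: dist_Pair_Pair dist_real_def)
      qed
    qed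
  qed
  moreover have "eventually (\<lambda>d. 0 < d) (at_right (0::real))"
    by (rule eventually_at_right_less)
  ultimately have "eventually (\<lambda>d. 0 < d \<and> (\<forall>(U, t)\<in>B. d < \<bar>barycenter p U - t\<bar>) \<and> (\<forall>t\<in>T. a < ereal (t - d) \<and> ereal (t + d) < b)
      \<and> (\<forall>t\<in>T. \<forall>k\<in>{..<K}. \<forall>s. \<bar>s - t\<bar> < d \<longrightarrow> s \<in> Theta a b \<longrightarrow> \<bar>f k (s, y t) - f k (t, y t)\<bar> < \<epsilon>)) (at_right 0)"
    by eventually_elim blast
  then have "\<exists>d. 0 < d \<and> (\<forall>(U, t)\<in>B. d < \<bar>barycenter p U - t\<bar>) \<and> (\<forall>t\<in>T. a < ereal (t - d) \<and> ereal (t + d) < b)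
      \<and> (\<forall>t\<in>T. \<forall>k\<in>{..<K}. \<forall>s. \<bar>s - t\<bar> < d \<longrightarrow> s \<in> Theta a b \<longrightarrow> \<bar>f k (s, y t) - f k (t, y t)\<bar> < \<epsilon>)"
    by (rule eventually_happens'[OF trivial_limit_at_right_real])
  then obtain \<delta> where d: "0 < \<delta>" "\<forall>(U, t)\<in>B. \<delta> < \<bar>barycenter p U - t\<bar>"
    "\<And>t. t \<in> T \<Longrightarrow> a < ereal (t - \<delta>) \<and> ereal (t + \<delta>) < b"
    "\<forall>t\<in>T. \<forall>k\<in>{..<K}. \<forall>s. \<bar>s - t\<bar> < \<delta> \<longrightarrow> s \<in> Theta a b \<longrightarrow> \<bar>f k (s, y t) - f k (t, y t)\<bar> < \<epsilon>"
    by blast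
  show thesis
  proof (rule that[OF d(1)])
    show "a \<le> ereal (t - \<delta>) \<and> ereal (t + \<delta>) \<le> b" if "t \<in> T" for t
      using d(3)[OF that] by (auto intro: less_imp_le)
    show "\<delta> \<le> \<bar>barycenter p U - t\<bar>" if "U \<subseteq> T" "U \<noteq> {}" "t \<in> T" "U \<noteq> {t}" for U t
      using bspec[OF d(2), of "(U, t)"] that by (simp add: B_def)
    \<comment> \<open>Continuity controls \<open>f k\<close> only for \<open>s\<close> in
      \<open>Theta a b\<close>; the margin around \<open>t\<close> places every \<open>s\<close>
      within \<open>\<delta>\<close> there.\<close>
    fix t k s assume *: "t \<in> T" "k < K" "\<bar>s - t\<bar> < \<delta>"
    then have "ereal (t - \<delta>) \<le> ereal s" "ereal s \<le> ereal (t + \<delta>)" by auto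
    then have "a < ereal s" "ereal s < b"
      using d(3)[OF *(1)] less_le_trans le_less_trans by blast+
    then have "s \<in> Theta a b" by (simp add: Theta_def less_imp_le)
    with * d(4) show "\<bar>f k (s, y t) - f k (t, y t)\<bar> < \<epsilon>" by (simp only: lessThan_iff)
  qed
qed

text \<open>The location \<open>t\<close> of \<open>z\<close> may be an end point of
  \<open>Theta a b\<close>. Interior points near it still form a nonempty open set: there are some
  to the right of \<open>t\<close> when \<open>t\<close> is below \<open>b\<close>, and to the left
  otherwise, where \<open>a < b\<close> provides the room.\<close>

lemma exists_interior_neighbourhood:
  fixes a b :: ereal and f :: "nat \<Rightarrow> real \<times> real \<Rightarrow> real"
  assumes ab: "a < b" and z: "z \<in> Theta a b \<times> {0..}"
    and f: "\<And>k. k < K \<Longrightarrow> continuous_on (Theta a b \<times> {0..}) (f k)" and \<epsilon>: "0 < \<epsilon>"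
  obtains V where "open V" "V \<noteq> {}" "\<And>s. s \<in> V \<Longrightarrow> a < ereal s \<and> ereal s < b"
    "\<And>s k. s \<in> V \<Longrightarrow> k < K \<Longrightarrow> \<bar>f k (s, snd z) - f k z\<bar> < \<epsilon>"
proof -
  obtain t y where zt: "z = (t, y)" "a \<le> ereal t" "ereal t \<le> b" "0 \<le> y"
    using z by (cases z) (auto simp: Theta_def)
  have "\<exists>d. \<forall>k\<in>{..<K}. 0 < d k \<and> (\<forall>z'\<in>Theta a b \<times> {0..}. dist z' z < d k \<longrightarrow> dist (f k z') (f k z) < \<epsilon>)"
  proof (rule bchoice, rule ballI)
    fix k assume "k \<in> {..<K}"
    then show "\<exists>d. 0 < d \<and> (\<forall>z'\<in>Theta a b \<times> {0..}. dist z' z < d \<longrightarrow> dist (f k z') (f k z) < \<epsilon>)"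
      using f[of k, unfolded continuous_on_iff, rule_format, OF _ z \<epsilon>] unfolding lessThan_iff by blast
  qed
  then obtain d where d: "\<And>k. k < K \<Longrightarrow> 0 < d k"
    "\<And>k z'. k < K \<Longrightarrow> z' \<in> Theta a b \<times> {0..} \<Longrightarrow> dist z' z < d k \<Longrightarrow> dist (f k z') (f k z) < \<epsilon>"
    by auto
  define e where "e = Min (insert 1 (d ` {..<K}))"
  have e: "0 < e" "\<And>k. k < K \<Longrightarrow> e \<le> d k" using d(1) by (auto simp: e_def)
  define V where "V = {s. \<bar>s - t\<bar> < e \<and> a < ereal s \<and> ereal s < b}"
  show thesis
  proof (rule that[of V])
    show "open V"
      unfolding V_def by (intro open_Collect_conj open_Collect_less continuous_intros continuous_on_ereal)
    have "\<exists>s. \<bar>s - t\<bar> < e \<and> a < ereal s \<and> ereal s < b"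
    proof (cases "ereal t < b")
      case True
      then have "ereal t < min b (ereal (t + e))" using e(1) by simp
      then obtain s where "ereal t < ereal s" "ereal s < min b (ereal (t + e))"
        using ereal_dense2 by blast
      then show ?thesis using zt by (intro exI[of _ s]) (auto intro: le_less_trans)
    next
      case False
      then have "max a (ereal (t - e)) < ereal t" using ab zt e(1) by auto
      then obtain s where s: "max a (ereal (t - e)) < ereal s" "ereal s < ereal t"
        using ereal_dense2 by blast
      have "ereal s < b" using s(2) zt(3) by (rule less_le_trans)
      with s show ?thesis by (intro exI[of _ s]) auto
    qed
    then show "V \<noteq> {}" by (auto simp: V_def)
    show "a < ereal s \<and> ereal s < b" if "s \<in> V" for s using that by (simp add: V_def)
    show "\<bar>f k (s, snd z) - f k z\<bar> < \<epsilon>" if "s \<in> V" "k < K" for s k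
    proof -
      have "(s, y) \<in> Theta a b \<times> {0..}"
        using that(1) zt(4) by (simp add: V_def Theta_def less_imp_le)
      moreover have "dist (s, y) z < d k"
        using that(1) e(2)[OF that(2)] zt(1) by (simp add: V_def dist_Pair_Pair dist_real_def)
      ultimately have "dist (f k (s, y)) (f k z) < \<epsilon>" by (rule d(2)[OF that(2)])
      then show ?thesis using zt(1) by (simp add: dist_real_def)
    qed
  qed
qed

text \<open>The tolerance is spent as \<open>\<epsilon> / 2\<close> on the finite mixture,
  \<open>\<epsilon> / 4\<close> on moving its locations to generic interior points and
  \<open>\<epsilon> / 4\<close> on the distance of the support points from the atoms. The first
  bound is strict, hence so is the total.\<close>

lemma exists_approximating_configuration:
  fixes a b :: ereal and f :: "nat \<Rightarrow> real \<times> real \<Rightarrow> real"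
  assumes ab: "a < b"
    and Q: "sets Q = sets borel" "prob_space Q" "emeasure Q (UNIV - Theta a b \<times> {0..}) = 0"
    and f: "\<And>k. k < K \<Longrightarrow> f k \<in> borel_measurable borel" "\<And>k. k < K \<Longrightarrow> continuous_on (Theta a b \<times> {0..}) (f k)"
      "\<And>k. k < K \<Longrightarrow> bounded (f k ` (Theta a b \<times> {0..}))"
    and \<epsilon>: "0 < \<epsilon>"
  obtains n x0 y0 where "1 \<le> n"
    "\<And>j k. k < 2 ^ j \<Longrightarrow> node a b x0 j k < node a b x0 j (Suc k)"
    "\<And>q. q \<in> Lev (Suc n) \<Longrightarrow> a < ereal (x0 q) \<and> ereal (x0 q) < b"
    "\<And>l. l \<in> {1..2 ^ n} \<Longrightarrow> 0 \<le> y0 l"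
    "\<And>k. k < K \<Longrightarrow> \<bar>(\<Sum>l\<in>{1..2 ^ n}. max 0 (dsba_w a b n x0 l) * f k (dsba_theta a b n x0 l, y0 l)) - (\<integral>z. f k z \<partial>Q)\<bar> < \<epsilon>"
proof -
  have e4: "0 < \<epsilon> / 4" using \<epsilon> by simp
  let ?S = "Theta a b \<times> {0..} :: (real \<times> real) set"
  have "closed (Theta a b)"
    unfolding Theta_def by (intro closed_Collect_conj closed_Collect_le continuous_intros continuous_on_ereal)
  then have S: "?S \<in> sets borel" by (intro borel_closed closed_Times) auto
  obtain I :: "(nat \<Rightarrow> int) set" and z p where I: "finite I" "\<And>i. i \<in> I \<Longrightarrow> z i \<in> ?S" "\<And>i. i \<in> I \<Longrightarrow> 0 < p i" "sum p I = 1"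
    and quant: "\<And>k. k < K \<Longrightarrow> \<bar>(\<Sum>i\<in>I. p i * f k (z i)) - (\<integral>x. f k x \<partial>Q)\<bar> < \<epsilon> / 2"
    by (rule exists_finite_quantization[OF Q(1,2) S Q(3) f(1,3) half_gt_zero[OF \<epsilon>]]) blast+
  have "\<exists>V. \<forall>i\<in>I. open (V i) \<and> V i \<noteq> {} \<and> (\<forall>s\<in>V i. a < ereal s \<and> ereal s < b)
      \<and> (\<forall>s\<in>V i. \<forall>k<K. \<bar>f k (s, snd (z i)) - f k (z i)\<bar> < \<epsilon> / 4)"
  proof (rule bchoice, rule ballI)
    fix i assume i: "i \<in> I"
    obtain V where "open V" "V \<noteq> {}" "\<And>s. s \<in> V \<Longrightarrow> a < ereal s \<and> ereal s < b"
      "\<And>s k. s \<in> V \<Longrightarrow> k < K \<Longrightarrow> \<bar>f k (s, snd (z i)) - f k (z i)\<bar> < \<epsilon> / 4"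
      by (rule exists_interior_neighbourhood[OF ab I(2)[OF i] f(2) e4]) blast+
    then show "\<exists>V. open V \<and> V \<noteq> {} \<and> (\<forall>s\<in>V. a < ereal s \<and> ereal s < b)
      \<and> (\<forall>s\<in>V. \<forall>k<K. \<bar>f k (s, snd (z i)) - f k (z i)\<bar> < \<epsilon> / 4)"
      by blast
  qed
  then obtain V where V: "\<And>i. i \<in> I \<Longrightarrow> open (V i)" "\<And>i. i \<in> I \<Longrightarrow> V i \<noteq> {}"
    "\<And>i s. i \<in> I \<Longrightarrow> s \<in> V i \<Longrightarrow> a < ereal s \<and> ereal s < b"
    "\<And>i s k. i \<in> I \<Longrightarrow> s \<in> V i \<Longrightarrow> k < K \<Longrightarrow> \<bar>f k (s, snd (z i)) - f k (z i)\<bar> < \<epsilon> / 4"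
    by metis
  obtain \<tau> where \<tau>: "\<And>i. i \<in> I \<Longrightarrow> \<tau> i \<in> V i"
    "\<And>U j. U \<subseteq> I \<Longrightarrow> U \<noteq> {} \<Longrightarrow> j \<in> I \<Longrightarrow> U \<noteq> {j} \<Longrightarrow> (\<Sum>u\<in>U. p u * (\<tau> u - \<tau> j)) \<noteq> 0"
    by (rule exists_generic_points[OF I(1) V(1,2) I(3)]) blast+
  \<comment> \<open>Genericity with \<open>U = {i}\<close> separates the locations, so weights and
    marks can be transferred from indices to locations even if several \<open>z i\<close> share
    their location.\<close>
  have inj: "inj_on \<tau> I"
  proof (rule inj_onI, rule ccontr)
    fix i j assume "i \<in> I" "j \<in> I" "\<tau> i = \<tau> j" "i \<noteq> j"
    then show False using \<tau>(2)[of "{i}" j] by simp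
  qed
  define T where "T = \<tau> ` I"
  define g where "g = the_inv_into I \<tau>"
  define pT where "pT t = p (g t)" for t
  define yT where "yT t = snd (z (g t))" for t
  have g\<tau>: "g (\<tau> i) = i" if "i \<in> I" for i
    unfolding g_def by (rule the_inv_into_f_f[OF inj that])
  have sumT: "(\<Sum>t\<in>\<tau> ` U. pT t * h t) = (\<Sum>i\<in>U. p i * h (\<tau> i))" if "U \<subseteq> I" for h :: "real \<Rightarrow> real" and U
    using inj_on_subset[OF inj that] that
    by (subst sum.reindex) (auto simp: pT_def g\<tau> subset_eq intro!: sum.cong)
  have T: "finite T" "T \<noteq> {}" using I by (auto simp: T_def)
  have pT: "0 < pT t" if "t \<in> T" for t using that I(3) by (auto simp: T_def pT_def g\<tau>)
  have pT1: "sum pT T = 1" using sumT[of I "\<lambda>_. 1"] I(4) by (simp add: T_def)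
  have inside: "a < ereal t \<and> ereal t < b" if "t \<in> T" for t
    using that V(3) \<tau>(1) by (auto simp: T_def)
  have yT: "0 \<le> yT t" if "t \<in> T" for t
    using that I(2) by (auto simp: T_def yT_def g\<tau> mem_Times_iff)
  have generic: "barycenter pT U \<noteq> t" if U: "U \<subseteq> T" "U \<noteq> {}" "t \<in> T" "U \<noteq> {t}" for U t
  proof
    assume eq: "barycenter pT U = t"
    obtain W where W: "W \<subseteq> I" "U = \<tau> ` W" using U(1) by (auto simp: T_def subset_image_iff)
    obtain j where j: "j \<in> I" "t = \<tau> j" using U(3) by (auto simp: T_def)
    have "0 < sum pT U"
      using U T pT by (intro sum_pos) (auto intro: finite_subset)
    \<comment> \<open>Multiplied by the positive total weight, equality of the barycenter with
      \<open>t\<close> becomes the vanishing sum that the choice of \<open>\<tau>\<close>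
      excludes.\<close>
    then have "(\<Sum>u\<in>U. pT u * u) = sum pT U * t" using eq by (auto simp: barycenter_def)
    then have "(\<Sum>u\<in>U. pT u * (u - t)) = 0"
      by (simp add: right_diff_distrib sum_subtractf sum_distrib_right)
    then have "(\<Sum>u\<in>W. p u * (\<tau> u - \<tau> j)) = 0"
      unfolding W(2) sumT[OF W(1)] j(2) .
    moreover have "W \<noteq> {}" "W \<noteq> {j}" using U W j by auto
    ultimately show False using \<tau>(2)[OF W(1) _ j(1)] by blast
  qed
  obtain \<delta> where d: "0 < \<delta>" "\<And>t. t \<in> T \<Longrightarrow> a \<le> ereal (t - \<delta>) \<and> ereal (t + \<delta>) \<le> b"
    "\<And>U t. U \<subseteq> T \<Longrightarrow> U \<noteq> {} \<Longrightarrow> t \<in> T \<Longrightarrow> U \<noteq> {t} \<Longrightarrow> \<delta> \<le> \<bar>barycenter pT U - t\<bar>"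
    "\<And>t k s. t \<in> T \<Longrightarrow> k < K \<Longrightarrow> \<bar>s - t\<bar> < \<delta> \<Longrightarrow> \<bar>f k (s, yT t) - f k (t, yT t)\<bar> < \<epsilon> / 4"
    by (rule exists_separation[OF T(1) inside generic yT f(2) e4]) blast+
  interpret separated_atoms a b T pT \<delta>
    by unfold_locales (use T pT pT1 d in auto)
  let ?n = "card T"
  obtain x0 col where x0: "\<And>j k. k < 2 ^ j \<Longrightarrow> node a b x0 j k < node a b x0 j (Suc k)"
    "\<And>q. q \<in> Lev (Suc ?n) \<Longrightarrow> a < ereal (x0 q) \<and> ereal (x0 q) < b"
    and w: "\<And>l. l \<in> {1..2 ^ ?n} \<Longrightarrow> 0 \<le> dsba_w a b ?n x0 l"
    and col: "\<And>l. l \<in> {1..2 ^ ?n} \<Longrightarrow> col l \<in> T"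
    "\<And>l. l \<in> {1..2 ^ ?n} \<Longrightarrow> \<bar>dsba_theta a b ?n x0 l - col l\<bar> < \<delta>"
    and mass: "\<And>h. (\<Sum>l\<in>{1..2 ^ ?n}. dsba_w a b ?n x0 l * h (col l)) = (\<Sum>t\<in>T. pT t * h t)"
    by (rule exists_nodes) blast
  show thesis
  proof (rule that[OF _ x0])
    \<comment> \<open>The weights add up to \<open>1\<close>, so there is at least one atom; this
      supplies the lower bound on \<open>n\<close> under which \<open>N\<close> is known to charge
      it.\<close>
    show "1 \<le> ?n" using T by (simp add: Suc_le_eq card_gt_0_iff)
    show "0 \<le> yT (col l)" if "l \<in> {1..2 ^ ?n}" for l using yT[OF col(1)[OF that]] .
    fix k assume k: "k < K"
    let ?w = "dsba_w a b ?n x0" and ?th = "dsba_theta a b ?n x0" and ?L = "{1..2 ^ ?n} :: nat set"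
    have "\<bar>(\<Sum>l\<in>?L. ?w l * f k (?th l, yT (col l))) - (\<Sum>l\<in>?L. ?w l * f k (col l, yT (col l)))\<bar>
        = \<bar>\<Sum>l\<in>?L. ?w l * (f k (?th l, yT (col l)) - f k (col l, yT (col l)))\<bar>"
      by (simp add: sum_subtractf right_diff_distrib)
    also have "\<dots> \<le> (\<Sum>l\<in>?L. \<bar>?w l * (f k (?th l, yT (col l)) - f k (col l, yT (col l)))\<bar>)"
      by (rule sum_abs)
    also have "\<dots> \<le> (\<Sum>l\<in>?L. ?w l * (\<epsilon> / 4))"
    proof (rule sum_mono)
      fix l assume l: "l \<in> ?L"
      show "\<bar>?w l * (f k (?th l, yT (col l)) - f k (col l, yT (col l)))\<bar> \<le> ?w l * (\<epsilon> / 4)"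
        unfolding abs_mult using w[OF l] d(4)[OF col(1)[OF l] k col(2)[OF l]]
        by (intro mult_mono) auto
    qed
    also have "\<dots> = \<epsilon> / 4"
      using mass[of "\<lambda>_. 1"] pT1 unfolding sum_distrib_right[symmetric] by simp
    finally have 1: "\<bar>(\<Sum>l\<in>?L. ?w l * f k (?th l, yT (col l))) - (\<Sum>l\<in>?L. ?w l * f k (col l, yT (col l)))\<bar> \<le> \<epsilon> / 4" .
    have "(\<Sum>l\<in>?L. ?w l * f k (col l, yT (col l))) = (\<Sum>t\<in>T. pT t * f k (t, yT t))"
      by (rule mass[of "\<lambda>t. f k (t, yT t)"])
    also have "\<dots> = (\<Sum>i\<in>I. p i * f k (\<tau> i, yT (\<tau> i)))"
      unfolding T_def by (rule sumT) simp
    also have "\<dots> = (\<Sum>i\<in>I. p i * f k (\<tau> i, snd (z i)))"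
      by (intro sum.cong refl) (simp add: yT_def g\<tau>)
    finally have 2: "(\<Sum>l\<in>?L. ?w l * f k (col l, yT (col l))) = (\<Sum>i\<in>I. p i * f k (\<tau> i, snd (z i)))" .
    have "\<bar>(\<Sum>i\<in>I. p i * f k (\<tau> i, snd (z i))) - (\<Sum>i\<in>I. p i * f k (z i))\<bar>
        = \<bar>\<Sum>i\<in>I. p i * (f k (\<tau> i, snd (z i)) - f k (z i))\<bar>"
      by (simp add: sum_subtractf right_diff_distrib)
    also have "\<dots> \<le> (\<Sum>i\<in>I. \<bar>p i * (f k (\<tau> i, snd (z i)) - f k (z i))\<bar>)"
      by (rule sum_abs)
    also have "\<dots> \<le> (\<Sum>i\<in>I. p i * (\<epsilon> / 4))"
    proof (rule sum_mono)
      fix i assume i: "i \<in> I"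
      show "\<bar>p i * (f k (\<tau> i, snd (z i)) - f k (z i))\<bar> \<le> p i * (\<epsilon> / 4)"
        unfolding abs_mult using I(3)[OF i] V(4)[OF i \<tau>(1)[OF i] k]
        by (intro mult_mono) auto
    qed
    also have "\<dots> = \<epsilon> / 4" unfolding sum_distrib_right[symmetric] I(4) by simp
    finally have 3: "\<bar>(\<Sum>i\<in>I. p i * f k (\<tau> i, snd (z i))) - (\<Sum>i\<in>I. p i * f k (z i))\<bar> \<le> \<epsilon> / 4" .
    have "(\<Sum>l\<in>?L. max 0 (?w l) * f k (?th l, yT (col l))) = (\<Sum>l\<in>?L. ?w l * f k (?th l, yT (col l)))"
      using w by (intro sum.cong refl) (simp add: max_def)
    then show "\<bar>(\<Sum>l\<in>?L. max 0 (?w l) * f k (?th l, yT (col l))) - (\<integral>z. f k z \<partial>Q)\<bar> < \<epsilon>"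
      using 1 2 3 quant[OF k] by linarith
  qed
qed

text \<open>Finitely many bounded continuous test functions and a tolerance describe the basic weak
  neighbourhoods of \<open>Q\<close>, so positive probability of all of them says that
  \<open>Q\<close> lies in the support. Laws on \<open>Theta a b \<times> {0..}\<close> appear as
  measures on the plane with null complement. The law of \<open>G\<close> is a mixture over
  \<open>n\<close>, hence the outer integral against \<open>N\<close>.\<close>

theorem theorem6:
  fixes a b :: ereal
    and N :: "nat pmf"
    and H :: "nat \<Rightarrow> nat \<Rightarrow> nat \<Rightarrow> real measure"
    and P :: "real measure"
  assumes ab: "a < b"
    and N_full: "\<forall>n\<ge>1. pmf N n > 0"
    and H_prob: "\<forall>n j k. 1 \<le> j \<and> j \<le> n + 1 \<and> k \<in> odd_idx j \<longrightarrow>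
        sets (H n j k) = sets borel \<and> prob_space (H n j k)
        \<and> emeasure (H n j k) (UNIV - Theta a b) = 0
        \<and> absolutely_continuous lborel (H n j k)
        \<and> (\<forall>U. open U \<and> U \<inter> Theta a b \<noteq> {} \<longrightarrow> emeasure (H n j k) U > 0)"
    and H_moment: "\<forall>n j k. 1 \<le> j \<and> j \<le> n + 1 \<and> k \<in> odd_idx j
        \<and> (k = 1 \<or> k = 2 ^ (j + 1) - 3) \<longrightarrow> integrable (H n j k) (\<lambda>x. x)"
    and P_prob: "sets P = sets borel" "prob_space P" "emeasure P {..<0} = 0"
    and P_full: "\<forall>U. open U \<and> U \<inter> {0..} \<noteq> {} \<longrightarrow> emeasure P U > 0"
  shows "\<forall>(Q :: (real \<times> real) measure) (K :: nat) (f :: nat \<Rightarrow> real \<times> real \<Rightarrow> real) (\<epsilon> :: real).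
      sets Q = sets borel \<and> prob_space Q \<and> emeasure Q (UNIV - Theta a b \<times> {0..}) = 0
      \<and> \<epsilon> > 0
      \<and> (\<forall>i<K. f i \<in> borel_measurable borel \<and> continuous_on (Theta a b \<times> {0..}) (f i)
              \<and> bounded (f i ` (Theta a b \<times> {0..})))
      \<longrightarrow> (\<integral>\<^sup>+ n. emeasure (dsba_joint a b (H n) P n)
             {\<omega> \<in> space (dsba_joint a b (H n) P n).
                \<forall>i<K. \<bar>(\<integral>z. f i z \<partial>dsba_G a b n \<omega>) - (\<integral>z. f i z \<partial>Q)\<bar> < \<epsilon>} \<partial>measure_pmf N) > 0"
proof (intro allI impI, elim conjE)
  fix Q :: "(real \<times> real) measure" and K :: nat and f :: "nat \<Rightarrow> real \<times> real \<Rightarrow> real" and \<epsilon> :: real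
  assume Q: "sets Q = sets borel" "prob_space Q" "emeasure Q (UNIV - Theta a b \<times> {0..}) = 0"
    and \<epsilon>: "\<epsilon> > 0"
    and f: "\<forall>i<K. f i \<in> borel_measurable borel \<and> continuous_on (Theta a b \<times> {0..}) (f i)
              \<and> bounded (f i ` (Theta a b \<times> {0..}))"
  let ?e = "\<lambda>n. emeasure (dsba_joint a b (H n) P n)
             {\<omega> \<in> space (dsba_joint a b (H n) P n).
                \<forall>i<K. \<bar>(\<integral>z. f i z \<partial>dsba_G a b n \<omega>) - (\<integral>z. f i z \<partial>Q)\<bar> < \<epsilon>}"
  obtain n x0 y0 where n: "1 \<le> n"
    and x0: "\<And>j k. k < 2 ^ j \<Longrightarrow> node a b x0 j k < node a b x0 j (Suc k)"
      "\<And>q. q \<in> Lev (Suc n) \<Longrightarrow> a < ereal (x0 q) \<and> ereal (x0 q) < b"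
    and y0: "\<And>l. l \<in> {1..2 ^ n} \<Longrightarrow> 0 \<le> y0 l"
    and close: "\<And>k. k < K \<Longrightarrow> \<bar>(\<Sum>l\<in>{1..2 ^ n}. max 0 (dsba_w a b n x0 l) * f k (dsba_theta a b n x0 l, y0 l)) - (\<integral>z. f k z \<partial>Q)\<bar> < \<epsilon>"
    using exists_approximating_configuration[OF ab Q, of K f \<epsilon>] f \<epsilon> by blast
  have pos: "0 < ?e n"
  proof (rule dsba_event_pos[OF _ _ _ P_prob _ x0(1) x0(2) y0 _ _ close])
    show "sets (H n j k) = sets borel" "prob_space (H n j k)" if "1 \<le> j" "j \<le> Suc n" "k \<in> odd_idx j" for j k
      using H_prob that by auto
    show "0 < emeasure (H n j k) U" if "1 \<le> j" "j \<le> Suc n" "k \<in> odd_idx j" "open U" "U \<inter> Theta a b \<noteq> {}" for j k U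
      using H_prob that by auto
  qed (use P_full f in auto)
  show "0 < (\<integral>\<^sup>+ n. ?e n \<partial>measure_pmf N)"
  \<comment> \<open>An average of nonnegative terms vanishes only if every term of positive weight
    does, so one good \<open>n\<close> is enough.\<close>
  proof (rule ccontr)
    assume "\<not> ?thesis"
    then have "(\<integral>\<^sup>+ n. ?e n \<partial>measure_pmf N) = 0" by simp
    then have "AE n in measure_pmf N. ?e n = 0"
      by (subst (asm) nn_integral_0_iff_AE) auto
    then have "?e n = 0"
      using N_full n by (auto simp: AE_measure_pmf_iff set_pmf_iff)
    with pos show False by simp
  qed
qed

end
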